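(* Let $n>10$ be an integer, let $B$ be a collection of $4$-blocks of $[n]$, and let $p=\binom{n}{3}/4$. Let $K$ be a field, let $S=K\left[x_A : A\in\binom{[n]}{2}\right]$, and let $M_B^{(2)}\subseteq S$ be the $2$-shadow ideal of $B$. Then $([n],B)$ is an $S(3,4,n)$ if and only if $b_i(S/M_B^{(2)})=\binom{p}{i}$ for all $i=0,\ldots,5$.
   Context: $[n]=\{1,\ldots,n\}$. For a set $m$, $\binom{m}{s}$ denotes the collection of all $s$-element subsets of $m$. A $k$-block of $[n]$ is an element of $\binom{[n]}{k}$. A Steiner system $S(t,k,n)$ is a pair $([n],B)$ where $B\subseteq\binom{[n]}{k}$ is such that every $t$-block of $[n]$ is contained in a unique $k$-block in $B$. For $B\subseteq\binom{[n]}{k}$, the $s$-shadow ideal of $B$ is the squarefree monomial ideal $M_B^{(s)}=\left(\prod_{A\in\binom{m}{s}}x_A : m\in B\right)$ of the polynomial ring $S=K\left[x_A : A\in\binom{[n]}{s}\right]$, whose variables are indexed by the $s$-element subsets of $[n]$. For a monomial ideal $M$ of $S$, $b_i(S/M)$ denotes the $i$-th (total) Betti number of $S/M$, i.e. the rank of the free module in homological degree $i$ of the minimal (multigraded) free resolution of $S/M$ over $S$ (homological degree $0$ corresponds to $S$ itself and $b_1$ is the number of minimal generators of $M$). For a possibly non-integer $p$, $\binom{p}{i}=p(p-1)\cdots(p-i+1)/i!$. *)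

theory Defs
  imports
    Complex_Main
    "HOL-Library.Poly_Mapping"
    "HOL-Library.Ramsey"
    "HOL-Algebra.Ideal"
    "Jordan_Normal_Form.Matrix"
begin

section \<open>Steiner systems\<close>

definition steiner_system :: "nat \<Rightarrow> nat \<Rightarrow> nat \<Rightarrow> nat set set \<Rightarrow> bool" where
  "steiner_system t k n B \<longleftrightarrow>
     B \<subseteq> nsets {1..n} k \<and> (\<forall>T\<in>nsets {1..n} t. \<exists>!m. m \<in> B \<and> T \<subseteq> m)"

section \<open>Polynomial rings\<close>

text \<open>A polynomial is a finitely supported map from exponent vectors to coefficients; the
  addition of exponent vectors is the multiplication of monomials, and the exponent vector
  \<open>0\<close> is the monomial \<open>1\<close>.\<close>

type_synonym 'x monom = "'x \<Rightarrow>\<^sub>0 nat"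
type_synonym ('x, 'k) mpoly = "'x monom \<Rightarrow>\<^sub>0 'k"

definition mvar :: "'x \<Rightarrow> ('x, 'k::field) mpoly" where
  "mvar x = Poly_Mapping.single (Poly_Mapping.single x 1) 1"

text \<open>The polynomials over the field \<open>'k\<close> in the variables \<open>X\<close> only.\<close>

definition mpolys :: "'x set \<Rightarrow> ('x, 'k::field) mpoly set" where
  "mpolys X = {f. \<forall>a\<in>Poly_Mapping.keys f. Poly_Mapping.keys a \<subseteq> X}"

definition mpoly_ring :: "'x set \<Rightarrow> ('x, 'k::field) mpoly ring" where
  "mpoly_ring X = \<lparr>carrier = mpolys X, monoid.mult = (*), one = 1, zero = 0, add = (+)\<rparr>"

text \<open>The free module of rank \<open>r\<close> over that ring.\<close>

definition free_mod :: "'x set \<Rightarrow> nat \<Rightarrow> ('x, 'k::field) mpoly vec set" where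
  "free_mod X r = {v \<in> carrier_vec r. \<forall>j<r. v $ j \<in> mpolys X}"

definition shadow_ideal :: "nat \<Rightarrow> nat \<Rightarrow> nat set set \<Rightarrow> (nat set, 'k::field) mpoly set" where
  "shadow_ideal s n B =
     Idl\<^bsub>mpoly_ring (nsets {1..n} s)\<^esub> ((\<lambda>m. \<Prod>A\<in>nsets m s. mvar A) ` B)"

section \<open>Minimal multigraded free resolutions\<close>

text \<open>Let \<open>S\<close> be the polynomial ring in the variables \<open>X\<close> and \<open>I\<close> a monomial ideal of \<open>S\<close>.
  A multigraded free resolution of \<open>S/I\<close> by free modules of finite rank,
  \<open>\<dots> \<rightarrow> F\<^sub>2 \<rightarrow> F\<^sub>1 \<rightarrow> F\<^sub>0 \<rightarrow> S/I \<rightarrow> 0\<close>, is given in coordinates by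
  \<^item> the rank \<open>\<beta> i\<close> of \<open>F\<^sub>i\<close>, and the multidegree \<open>\<delta> i j\<close> of its \<open>j\<close>-th basis element
    for \<open>j < \<beta> i\<close>; that is, \<open>F\<^sub>i\<close> is the direct sum of the \<open>S(-\<delta> i j)\<close>;
  \<^item> the matrix \<open>d i\<close> of the differential \<open>F\<^sub>i \<rightarrow> F\<^sub>i\<^sub>-\<^sub>1\<close> for \<open>i > 0\<close> (\<open>d 0\<close> is not used);
  \<^item> a row vector \<open>\<epsilon>\<close> representing the augmentation \<open>F\<^sub>0 \<rightarrow> S/I\<close>, \<open>v \<mapsto> \<epsilon> \<bullet> v + I\<close>; every
    homomorphism from the free module \<open>F\<^sub>0\<close> to \<open>S/I\<close> is of this form.

  The two homogeneity conditions say that the maps preserve multidegrees.  Since \<open>S/I\<close> lives in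
  multidegrees with natural number entries, so do the basis elements of the minimal resolution,
  and it suffices to consider such shifts.  The remaining conditions are
  the surjectivity of the augmentation and exactness at \<open>F\<^sub>0\<close> and at \<open>F\<^sub>i\<close> for \<open>i > 0\<close>.\<close>

definition multigraded_free_resolution ::
  "'x set \<Rightarrow> ('x, 'k::field) mpoly set \<Rightarrow> (nat \<Rightarrow> nat) \<Rightarrow> (nat \<Rightarrow> nat \<Rightarrow> 'x monom) \<Rightarrow>
   ('x, 'k) mpoly vec \<Rightarrow> (nat \<Rightarrow> ('x, 'k) mpoly mat) \<Rightarrow> bool" where
  "multigraded_free_resolution X I \<beta> \<delta> \<epsilon> d \<longleftrightarrow>
     (\<forall>i. \<forall>j<\<beta> i. Poly_Mapping.keys (\<delta> i j) \<subseteq> X) \<and>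
     \<epsilon> \<in> free_mod X (\<beta> 0) \<and>
     (\<forall>i. d (Suc i) \<in> carrier_mat (\<beta> i) (\<beta> (Suc i)) \<and> elements_mat (d (Suc i)) \<subseteq> mpolys X) \<and>
     (\<forall>j<\<beta> 0. \<forall>a\<in>Poly_Mapping.keys (\<epsilon> $ j). a = \<delta> 0 j) \<and>
     (\<forall>i. \<forall>r<\<beta> i. \<forall>c<\<beta> (Suc i). \<forall>a\<in>Poly_Mapping.keys (d (Suc i) $$ (r, c)).
        a + \<delta> i r = \<delta> (Suc i) c) \<and>
     (\<forall>f\<in>mpolys X. \<exists>v\<in>free_mod X (\<beta> 0). f - \<epsilon> \<bullet> v \<in> I) \<and>
     {v \<in> free_mod X (\<beta> 0). \<epsilon> \<bullet> v \<in> I} = (\<lambda>w. d 1 *\<^sub>v w) ` free_mod X (\<beta> 1) \<and>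
     (\<forall>i. {v \<in> free_mod X (\<beta> (Suc i)). d (Suc i) *\<^sub>v v = 0\<^sub>v (\<beta> i)} =
          (\<lambda>w. d (Suc (Suc i)) *\<^sub>v w) ` free_mod X (\<beta> (Suc (Suc i))))"

text \<open>Minimality: the image of each differential lies in \<open>\<mm> F\<^sub>i\<close>, where \<open>\<mm>\<close> is the ideal
  generated by the variables, i.e. no entry of a matrix has a constant term.\<close>

definition minimal_free_resolution ::
  "'x set \<Rightarrow> ('x, 'k::field) mpoly set \<Rightarrow> (nat \<Rightarrow> nat) \<Rightarrow> (nat \<Rightarrow> nat \<Rightarrow> 'x monom) \<Rightarrow>
   ('x, 'k) mpoly vec \<Rightarrow> (nat \<Rightarrow> ('x, 'k) mpoly mat) \<Rightarrow> bool" where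
  "minimal_free_resolution X I \<beta> \<delta> \<epsilon> d \<longleftrightarrow>
     multigraded_free_resolution X I \<beta> \<delta> \<epsilon> d \<and>
     (\<forall>i. \<forall>f\<in>elements_mat (d (Suc i)). Poly_Mapping.lookup f 0 = 0)"

text \<open>The \<open>i\<close>-th total Betti number of \<open>S/I\<close>; the minimal free resolution of \<open>S/I\<close> exists
  and is unique up to isomorphism if \<open>X\<close> is finite and \<open>I\<close> is a monomial ideal.\<close>

definition betti_number :: "'x set \<Rightarrow> ('x, 'k::field) mpoly set \<Rightarrow> nat \<Rightarrow> nat" where
  "betti_number X I i = (THE r. \<exists>\<beta> \<delta> \<epsilon> d. minimal_free_resolution X I \<beta> \<delta> \<epsilon> d \<and> \<beta> i = r)"

end

theory Submission
  imports Defs "Jordan_Normal_Form.Determinant"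
begin

text \<open>A multigraded resolution with squarefree degrees is encoded by scalars: a generator \<open>s\<close> carries
  a set \<open>E s\<close> of variables, and exactness over the polynomial ring amounts to exactness over the
  field of every strand \<open>{s. E s \<subseteq> A}\<close>.  The Taylor complex is of this kind.  Cancelling two generators
  with the same set and a nonzero coefficient gives a smaller resolution, and the process
  ends in a minimal one; comparing two minimal resolutions modulo the variables shows that
  their ranks agree.  Hence, if no generator divides the lcm of at most five others, then
  \<open>b\<^sub>i\<close> is the \<open>i\<close>-th binomial coefficient for \<open>i \<le> 5\<close>, whereas a generator dividing the lcm of
  \<open>k \<le> 4\<close> others makes \<open>b\<^sub>k\<^sub>+\<^sub>1\<close> strictly smaller.

  Two blocks of a Steiner system \<open>S(3,4,n)\<close> share at most one pair, so the six pairs in a block are not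
  covered by five other blocks.  Conversely, let \<open>|B| = p\<close> and suppose that no block is
  covered by four others.  A block sharing a triple with another one then has a private
  pair, since otherwise the latter and three more blocks would cover it.  If there are \<open>b\<close> such
  blocks, then their private pairs yield at least \<open>b (n - 4) / 3\<close> uncovered triples.  The triples are
  covered once on average, so the number of uncovered triples is at most the number of incidences
  of blocks with multiply covered triples, which is at most \<open>2 b\<close> because such a triple avoids the private
  pair.  Hence \<open>b = 0\<close> for \<open>n > 10\<close>.\<close>

section \<open>Polynomials and matrices of polynomials\<close>

lemma mpolys_0 [simp]: "0 \<in> mpolys X" by (simp add: mpolys_def)

lemma mpolys_single: "Poly_Mapping.keys a \<subseteq> X \<Longrightarrow> Poly_Mapping.single a c \<in> mpolys X"
  by (simp add: mpolys_def)

lemma mpolys_1 [simp]: "1 \<in> mpolys X"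
  by (simp add: mpolys_def)

lemma mpolys_add: "f \<in> mpolys X \<Longrightarrow> g \<in> mpolys X \<Longrightarrow> f + g \<in> mpolys X"
  using Poly_Mapping.keys_add[of f g] by (fastforce simp: mpolys_def)

lemma mpolys_uminus: "f \<in> mpolys X \<Longrightarrow> - f \<in> mpolys X"
  by (simp add: mpolys_def)

lemma mpolys_diff: "f \<in> mpolys X \<Longrightarrow> g \<in> mpolys X \<Longrightarrow> f - g \<in> mpolys X"
  using mpolys_add[of f X "- g"] mpolys_uminus[of g X] by simp

lemma mpolys_mult:
  assumes "f \<in> mpolys X" "g \<in> mpolys X"
  shows "f * g \<in> mpolys X"
  unfolding mpolys_def
proof (intro CollectI ballI)
  fix a assume "a \<in> Poly_Mapping.keys (f * g)"
  then obtain b c where "b \<in> Poly_Mapping.keys f" "c \<in> Poly_Mapping.keys g" "a = b + c"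
    using keys_mult[of f g] by blast
  then show "Poly_Mapping.keys a \<subseteq> X"
    using assms Poly_Mapping.keys_add[of b c] by (fastforce simp: mpolys_def)
qed

lemma mpolys_sum: "(\<And>i. i \<in> S \<Longrightarrow> f i \<in> mpolys X) \<Longrightarrow> sum f S \<in> mpolys X"
  by (induction S rule: infinite_finite_induct) (auto intro: mpolys_add)

text \<open>Exponents are natural numbers, so two exponent vectors add up to \<open>0\<close> only
  if both are \<open>0\<close>; hence constant terms multiply.\<close>

lemma lookup_mult_0:
  fixes f g :: "('x, 'k::field) mpoly"
  shows "Poly_Mapping.lookup (f * g) 0 = Poly_Mapping.lookup f 0 * Poly_Mapping.lookup g 0"
proof -
  have eq: "(0 = l + q) \<longleftrightarrow> l = 0 \<and> q = 0" for l q :: "'x monom"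
    by (auto simp: poly_mapping_eq_iff fun_eq_iff lookup_add)
  have "Poly_Mapping.lookup (f * g) 0 =
      (\<Sum>l. Poly_Mapping.lookup f l * (\<Sum>q. Poly_Mapping.lookup g q when 0 = l + q))"
    by (rule lookup_mult)
  also have "\<dots> = (\<Sum>l. (Poly_Mapping.lookup f l * Poly_Mapping.lookup g 0) when l = 0)"
    by (rule Sum_any.cong) (auto simp: eq when_def)
  also have "\<dots> = Poly_Mapping.lookup f 0 * Poly_Mapping.lookup g 0" by simp
  finally show ?thesis .
qed

text \<open>Reduction modulo the variables, in a form that can be applied to matrices entry by
  entry.\<close>

interpretation const_coeff: comm_ring_hom "\<lambda>f :: ('x, 'k::field) mpoly. Poly_Mapping.lookup f 0"
  by unfold_locales (simp_all add: lookup_mult_0 lookup_add)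

section \<open>Matrices over the polynomial ring\<close>

definition poly_mats :: "'x set \<Rightarrow> nat \<Rightarrow> nat \<Rightarrow> ('x, 'k::field) mpoly mat set" where
  "poly_mats X r c = {M \<in> carrier_mat r c. \<forall>i<r. \<forall>j<c. M $$ (i, j) \<in> mpolys X}"

lemma poly_matsD:
  assumes "M \<in> poly_mats X r c"
  shows "M \<in> carrier_mat r c" "i < r \<Longrightarrow> j < c \<Longrightarrow> M $$ (i, j) \<in> mpolys X"
  using assms by (auto simp: poly_mats_def)

lemma scalar_prod_mpolys:
  assumes "v \<in> free_mod X n" "w \<in> free_mod X n"
  shows "v \<bullet> w \<in> mpolys X"
  using assms by (auto simp: scalar_prod_def free_mod_def intro!: mpolys_sum mpolys_mult)

lemma row_free_mod: "M \<in> poly_mats X r c \<Longrightarrow> i < r \<Longrightarrow> row M i \<in> free_mod X c"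
  by (auto simp: poly_mats_def free_mod_def)

lemma col_free_mod: "M \<in> poly_mats X r c \<Longrightarrow> j < c \<Longrightarrow> col M j \<in> free_mod X r"
  by (auto simp: poly_mats_def free_mod_def)

lemma poly_mats_mult:
  assumes "A \<in> poly_mats X r m" "B \<in> poly_mats X m c"
  shows "A * B \<in> poly_mats X r c"
proof -
  have "(A * B) $$ (i, j) \<in> mpolys X" if "i < r" "j < c" for i j
  proof -
    have "(A * B) $$ (i, j) = row A i \<bullet> col B j"
      using assms that by (auto simp: poly_mats_def)
    then show ?thesis
      using scalar_prod_mpolys[OF row_free_mod[OF assms(1)] col_free_mod[OF assms(2)]] that by simp
  qed
  then show ?thesis using assms by (auto simp: poly_mats_def)
qed

lemma poly_mats_diff: "A \<in> poly_mats X r c \<Longrightarrow> B \<in> poly_mats X r c \<Longrightarrow> A - B \<in> poly_mats X r c"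
  by (auto simp: poly_mats_def intro!: mpolys_diff)

lemma poly_mats_one: "1\<^sub>m n \<in> poly_mats X n n"
  by (auto simp: poly_mats_def)

lemma poly_mats_zero: "0\<^sub>m r c \<in> poly_mats X r c"
  by (auto simp: poly_mats_def)

lemma poly_mats_mult_vec:
  assumes "A \<in> poly_mats X r c" "v \<in> free_mod X c"
  shows "A *\<^sub>v v \<in> free_mod X r"
proof -
  have "(A *\<^sub>v v) $ i \<in> mpolys X" if "i < r" for i
    using assms that scalar_prod_mpolys[OF row_free_mod[OF assms(1)] assms(2)]
    by (auto simp: poly_mats_def)
  then show ?thesis using assms by (auto simp: poly_mats_def free_mod_def)
qed

lemma unit_vec_free_mod: "unit_vec n i \<in> free_mod X n"
  by (auto simp: free_mod_def unit_vec_def)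

lemma mult_mat_unit_vec:
  fixes A :: "'a :: comm_ring_1 mat"
  assumes "A \<in> carrier_mat r c" "j < c"
  shows "A *\<^sub>v unit_vec c j = col A j"
  using assms by (intro eq_vecI) auto

text \<open>Chosen preimages of the columns of \<open>M\<close> become the columns of
  \<open>W\<close>. This turns exactness, a statement about vectors, into a factorisation of
  matrices.\<close>

lemma lift_columns:
  assumes "M \<in> carrier_mat k n" "A \<in> carrier_mat k m"
    and "\<And>j. j < n \<Longrightarrow> \<exists>w\<in>free_mod X m. A *\<^sub>v w = col M j"
  shows "\<exists>W\<in>poly_mats X m n. A * W = M"
proof -
  have "\<forall>j\<in>{..<n}. \<exists>w. w \<in> free_mod X m \<and> A *\<^sub>v w = col M j" using assms(3) by auto
  then obtain w where "\<forall>j\<in>{..<n}. w j \<in> free_mod X m \<and> A *\<^sub>v w j = col M j"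
    by (rule bchoice[THEN exE])
  then have w: "w j \<in> free_mod X m" "A *\<^sub>v w j = col M j" if "j < n" for j using that by auto
  define W where "W = mat m n (\<lambda>(i, j). w j $ i)"
  have col: "col W j = w j" if "j < n" for j
    using w[OF that] that by (intro eq_vecI) (auto simp: W_def free_mod_def)
  have "W \<in> poly_mats X m n" using w by (auto simp: W_def poly_mats_def free_mod_def)
  moreover have "A * W = M"
  proof (rule eq_matI)
    fix i j assume ij: "i < dim_row M" "j < dim_col M"
    then have "i < k" "j < n" using assms by auto
    then have "(A * W) $$ (i, j) = row A i \<bullet> col W j" using assms by (simp add: W_def)
    also have "\<dots> = (A *\<^sub>v w j) $ i" using assms col \<open>j < n\<close> \<open>i < k\<close> by simp
    also have "\<dots> = M $$ (i, j)" using w \<open>j < n\<close> \<open>i < k\<close> assms by simp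
    finally show "(A * W) $$ (i, j) = M $$ (i, j)" .
  qed (use assms in \<open>auto simp: W_def\<close>)
  ultimately show ?thesis by blast
qed

text \<open>If \<open>n < m\<close>, pad \<open>A\<close> with zero columns and \<open>B\<close>
  with zero rows to square matrices. Their product is still the identity, hence so is the product in
  the reverse order, whose diagonal entry at \<open>n\<close> is \<open>0\<close>: a
  contradiction.\<close>

lemma mult_eq_one_imp_dim_le:
  fixes A B :: "'a::field mat"
  assumes A: "A \<in> carrier_mat m n" and B: "B \<in> carrier_mat n m" and AB: "A * B = 1\<^sub>m m"
  shows "m \<le> n"
proof (rule ccontr)
  assume "\<not> m \<le> n"
  then have "n < m" by simp
  define A' where "A' = mat m m (\<lambda>(i, j). if j < n then A $$ (i, j) else 0)"
  define B' where "B' = mat m m (\<lambda>(i, j). if i < n then B $$ (i, j) else 0)"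
  have car: "A' \<in> carrier_mat m m" "B' \<in> carrier_mat m m" by (auto simp: A'_def B'_def)
  have "A' * B' = 1\<^sub>m m"
  proof (rule eq_matI)
    fix i j assume "i < dim_row (1\<^sub>m m :: 'a mat)" "j < dim_col (1\<^sub>m m :: 'a mat)"
    then have ij: "i < m" "j < m" by auto
    have "(A' * B') $$ (i, j) =
        (\<Sum>k\<in>{0..<m}. (if k < n then A $$ (i, k) else 0) * (if k < n then B $$ (k, j) else 0))"
      using ij by (simp add: A'_def B'_def scalar_prod_def)
    also have "\<dots> = (\<Sum>k\<in>{0..<n}. A $$ (i, k) * B $$ (k, j))"
      using \<open>n < m\<close> by (intro sum.mono_neutral_cong_right) auto
    also have "\<dots> = (A * B) $$ (i, j)"
      using ij A B by (simp add: scalar_prod_def)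
    finally show "(A' * B') $$ (i, j) = 1\<^sub>m m $$ (i, j)" using AB by simp
  qed (use car in auto)
  then have "B' * A' = 1\<^sub>m m" using mat_mult_left_right_inverse[OF car] by simp
  then have "(B' * A') $$ (n, n) = 1" using \<open>n < m\<close> by simp
  moreover have "row B' n \<bullet> col A' n = 0"
    using \<open>n < m\<close> by (simp add: A'_def B'_def scalar_prod_def)
  ultimately show False using car \<open>n < m\<close> by simp
qed

section \<open>Comparison of resolutions\<close>

text \<open>Ideals in terms of the operations of the type; \<open>ideal_mpoly_ringI\<close> leads
  back to the ring record.\<close>

definition mpoly_ideal :: "'x set \<Rightarrow> ('x, 'k::field) mpoly set \<Rightarrow> bool" where
  "mpoly_ideal X I \<longleftrightarrow> I \<subseteq> mpolys X \<and> 0 \<in> I \<and> (\<forall>a\<in>I. \<forall>b\<in>I. a + b \<in> I) \<and> (\<forall>f\<in>mpolys X. \<forall>a\<in>I. f * a \<in> I)"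

lemma mpoly_idealD:
  assumes "mpoly_ideal X I"
  shows "I \<subseteq> mpolys X" "0 \<in> I" "a \<in> I \<Longrightarrow> b \<in> I \<Longrightarrow> a + b \<in> I"
    "f \<in> mpolys X \<Longrightarrow> a \<in> I \<Longrightarrow> f * a \<in> I"
  using assms by (auto simp: mpoly_ideal_def)

lemma mpoly_ideal_uminus: "mpoly_ideal X I \<Longrightarrow> a \<in> I \<Longrightarrow> - a \<in> I"
  using mpoly_idealD(4)[of X I "- 1" a] mpolys_uminus[of 1 X] by simp

lemma mpoly_ideal_sum:
  "mpoly_ideal X I \<Longrightarrow> (\<And>i. i \<in> S \<Longrightarrow> f i \<in> I) \<Longrightarrow> sum f S \<in> I"
  by (induction S rule: infinite_finite_induct) (auto intro: mpoly_idealD)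

text \<open>Degree \<open>0\<close> takes the kernel of the augmentation to \<open>S/I\<close>, so
  that exactness becomes one equation for all degrees.\<close>

definition cycles ::
  "'x set \<Rightarrow> ('x, 'k::field) mpoly set \<Rightarrow> (nat \<Rightarrow> nat) \<Rightarrow> ('x, 'k) mpoly vec \<Rightarrow>
   (nat \<Rightarrow> ('x, 'k) mpoly mat) \<Rightarrow> nat \<Rightarrow> ('x, 'k) mpoly vec set" where
  "cycles X I \<beta> \<epsilon> d i =
     {v \<in> free_mod X (\<beta> i). if i = 0 then \<epsilon> \<bullet> v \<in> I else d i *\<^sub>v v = 0\<^sub>v (\<beta> (i - 1))}"

text \<open>A resolution with its multidegrees forgotten, which is the setting for comparing two
  resolutions. Minimality enters later as a separate assumption.\<close>

locale poly_resolution =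
  fixes X :: "'x set" and I :: "('x, 'k::field) mpoly set"
    and \<beta> :: "nat \<Rightarrow> nat" and \<epsilon> :: "('x, 'k) mpoly vec" and d :: "nat \<Rightarrow> ('x, 'k) mpoly mat"
  assumes ideal: "mpoly_ideal X I"
    and eps: "\<epsilon> \<in> free_mod X (\<beta> 0)"
    and mats: "d (Suc i) \<in> poly_mats X (\<beta> i) (\<beta> (Suc i))"
    and surj: "f \<in> mpolys X \<Longrightarrow> \<exists>v\<in>free_mod X (\<beta> 0). f - \<epsilon> \<bullet> v \<in> I"
    and exact: "cycles X I \<beta> \<epsilon> d i = (\<lambda>w. d (Suc i) *\<^sub>v w) ` free_mod X (\<beta> (Suc i))"
begin

lemma d_carrier: "d (Suc i) \<in> carrier_mat (\<beta> i) (\<beta> (Suc i))"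
  using mats by (rule poly_matsD)

lemma boundary_cycle: "w \<in> free_mod X (\<beta> (Suc i)) \<Longrightarrow> d (Suc i) *\<^sub>v w \<in> cycles X I \<beta> \<epsilon> d i"
  unfolding exact by blast

lemma d_square: "d (Suc i) * d (Suc (Suc i)) = 0\<^sub>m (\<beta> i) (\<beta> (Suc (Suc i)))"
proof (rule eq_matI)
  fix r c assume "r < dim_row (0\<^sub>m (\<beta> i) (\<beta> (Suc (Suc i))) :: ('x, 'k) mpoly mat)"
    "c < dim_col (0\<^sub>m (\<beta> i) (\<beta> (Suc (Suc i))) :: ('x, 'k) mpoly mat)"
  then have rc: "r < \<beta> i" "c < \<beta> (Suc (Suc i))" by auto
  have "col (d (Suc (Suc i))) c \<in> cycles X I \<beta> \<epsilon> d (Suc i)"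
    using boundary_cycle[OF unit_vec_free_mod] mult_mat_unit_vec[OF d_carrier rc(2)] by metis
  then have "d (Suc i) *\<^sub>v col (d (Suc (Suc i))) c = 0\<^sub>v (\<beta> i)" by (simp add: cycles_def)
  then have "(d (Suc i) *\<^sub>v col (d (Suc (Suc i))) c) $ r = 0" using rc by simp
  then show "(d (Suc i) * d (Suc (Suc i))) $$ (r, c) = 0\<^sub>m (\<beta> i) (\<beta> (Suc (Suc i))) $$ (r, c)"
    using rc d_carrier[of i] d_carrier[of "Suc i"] by simp
qed (use d_carrier in auto)

text \<open>The columns of \<open>M\<close> are the images of unit vectors, hence cycles, hence
  boundaries by exactness.\<close>

lemma lift:
  assumes "M \<in> poly_mats X (\<beta> i) n"
    and "\<And>v. v \<in> free_mod X n \<Longrightarrow> M *\<^sub>v v \<in> cycles X I \<beta> \<epsilon> d i"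
  shows "\<exists>W\<in>poly_mats X (\<beta> (Suc i)) n. d (Suc i) * W = M"
proof (rule lift_columns[OF poly_matsD(1)[OF assms(1)] d_carrier])
  fix j assume "j < n"
  then have "col M j \<in> cycles X I \<beta> \<epsilon> d i"
    using assms(2)[OF unit_vec_free_mod, of j] mult_mat_unit_vec[OF poly_matsD(1)[OF assms(1)]] by simp
  then show "\<exists>w\<in>free_mod X (\<beta> (Suc i)). d (Suc i) *\<^sub>v w = col M j" unfolding exact by auto
qed

end

section \<open>Chain maps over the identity of \<open>S/I\<close>\<close>

text \<open>Built degree by degree: if \<open>\<phi> n\<close> sends cycles to cycles, then
  \<open>\<phi> n * d (Suc n)\<close> takes values in the cycles of the target and factors through
  the next differential there.\<close>

lemma comparison_map:
  assumes F: "poly_resolution X I \<beta> \<epsilon> d" and G: "poly_resolution X I \<beta>' \<epsilon>' d'"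
  obtains \<phi> where "\<And>i. \<phi> i \<in> poly_mats X (\<beta>' i) (\<beta> i)"
    and "\<And>v. v \<in> free_mod X (\<beta> 0) \<Longrightarrow> \<epsilon>' \<bullet> (\<phi> 0 *\<^sub>v v) - \<epsilon> \<bullet> v \<in> I"
    and "\<And>i. d' (Suc i) * \<phi> (Suc i) = \<phi> i * d (Suc i)"
proof -
  interpret F: poly_resolution X I \<beta> \<epsilon> d by (rule F)
  interpret G: poly_resolution X I \<beta>' \<epsilon>' d' by (rule G)
  note I = mpoly_idealD[OF F.ideal]
  define cF where "cF = cycles X I \<beta> \<epsilon> d"
  define cG where "cG = cycles X I \<beta>' \<epsilon>' d'"
  \<comment> \<open>The invariant of the recursion. Preservation of cycles makes the next step
    possible; the last conjunct says that the map in degree \<open>0\<close> lifts the identity of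
    \<open>S/I\<close>.\<close>
  define P where "P = (\<lambda>n \<phi>. \<phi> \<in> poly_mats X (\<beta>' n) (\<beta> n) \<and> (\<forall>v\<in>cF n. \<phi> *\<^sub>v v \<in> cG n) \<and>
     (n = 0 \<longrightarrow> (\<forall>v\<in>free_mod X (\<beta> 0). \<epsilon>' \<bullet> (\<phi> *\<^sub>v v) - \<epsilon> \<bullet> v \<in> I)))"
  have base: "\<exists>\<phi>. P 0 \<phi>"
  proof -
    \<comment> \<open>By surjectivity of the second augmentation, each basis vector has a partner
      with the same augmentation modulo \<open>I\<close>; the partners are the columns of
      \<open>\<phi>\<close>.\<close>
    have "\<forall>j\<in>{..<\<beta> 0}. \<exists>v. v \<in> free_mod X (\<beta>' 0) \<and> \<epsilon> $ j - \<epsilon>' \<bullet> v \<in> I"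
      using G.surj F.eps by (auto simp: free_mod_def)
    then obtain w where "\<forall>j\<in>{..<\<beta> 0}. w j \<in> free_mod X (\<beta>' 0) \<and> \<epsilon> $ j - \<epsilon>' \<bullet> w j \<in> I"
      by (rule bchoice[THEN exE])
    then have w: "w j \<in> free_mod X (\<beta>' 0)" "\<epsilon> $ j - \<epsilon>' \<bullet> w j \<in> I" if "j < \<beta> 0" for j
      using that by auto
    define \<phi> where "\<phi> = mat (\<beta>' 0) (\<beta> 0) (\<lambda>(i, j). w j $ i)"
    have \<phi>: "\<phi> \<in> poly_mats X (\<beta>' 0) (\<beta> 0)"
      using w by (auto simp: \<phi>_def poly_mats_def free_mod_def)
    have aug: "\<epsilon>' \<bullet> (\<phi> *\<^sub>v v) - \<epsilon> \<bullet> v \<in> I" if v: "v \<in> free_mod X (\<beta> 0)" for v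
    proof -
      have dv: "dim_vec v = \<beta> 0" "dim_vec \<epsilon> = \<beta> 0" "dim_vec \<epsilon>' = \<beta>' 0"
        using v F.eps G.eps by (auto simp: free_mod_def)
      have dw: "dim_vec (w j) = \<beta>' 0" if "j < \<beta> 0" for j
        using w[OF that] by (auto simp: free_mod_def)
      have "\<epsilon>' \<bullet> (\<phi> *\<^sub>v v) = (\<Sum>i<\<beta>' 0. \<epsilon>' $ i * (\<Sum>j<\<beta> 0. w j $ i * v $ j))"
        using dv by (simp add: scalar_prod_def \<phi>_def atLeast0LessThan)
      also have "\<dots> = (\<Sum>j<\<beta> 0. v $ j * (\<Sum>i<\<beta>' 0. \<epsilon>' $ i * w j $ i))"
        unfolding sum_distrib_left by (subst sum.swap) (simp add: mult_ac)
      also have "\<dots> = (\<Sum>j<\<beta> 0. v $ j * (\<epsilon>' \<bullet> w j))"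
        using dw by (simp add: scalar_prod_def atLeast0LessThan)
      finally have "\<epsilon>' \<bullet> (\<phi> *\<^sub>v v) = (\<Sum>j<\<beta> 0. v $ j * (\<epsilon>' \<bullet> w j))" .
      moreover have "\<epsilon> \<bullet> v = (\<Sum>j<\<beta> 0. v $ j * \<epsilon> $ j)"
        using dv by (simp add: scalar_prod_def atLeast0LessThan mult.commute)
      ultimately have "\<epsilon>' \<bullet> (\<phi> *\<^sub>v v) - \<epsilon> \<bullet> v = - (\<Sum>j<\<beta> 0. v $ j * (\<epsilon> $ j - \<epsilon>' \<bullet> w j))"
        by (simp add: right_diff_distrib sum_subtractf)
      moreover have "(\<Sum>j<\<beta> 0. v $ j * (\<epsilon> $ j - \<epsilon>' \<bullet> w j)) \<in> I"
        using w v by (intro mpoly_ideal_sum[OF F.ideal] I(4)) (auto simp: free_mod_def)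
      ultimately show ?thesis using mpoly_ideal_uminus[OF F.ideal] by simp
    qed
    have "\<phi> *\<^sub>v v \<in> cG 0" if "v \<in> cF 0" for v
    proof -
      have v: "v \<in> free_mod X (\<beta> 0)" "\<epsilon> \<bullet> v \<in> I" using that by (auto simp: cF_def cycles_def)
      have "(\<epsilon>' \<bullet> (\<phi> *\<^sub>v v) - \<epsilon> \<bullet> v) + \<epsilon> \<bullet> v \<in> I" using I(3)[OF aug[OF v(1)] v(2)] .
      then show ?thesis using poly_mats_mult_vec[OF \<phi> v(1)] by (simp add: cG_def cycles_def)
    qed
    then show ?thesis using \<phi> aug unfolding P_def by blast
  qed
  have step: "\<exists>\<phi>'. P (Suc n) \<phi>' \<and> d' (Suc n) * \<phi>' = \<phi> * d (Suc n)" if "P n \<phi>" for n \<phi>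
  proof -
    have \<phi>: "\<phi> \<in> poly_mats X (\<beta>' n) (\<beta> n)" and cyc: "\<And>v. v \<in> cF n \<Longrightarrow> \<phi> *\<^sub>v v \<in> cG n"
      using that by (auto simp: P_def)
    note car = poly_matsD(1)[OF \<phi>] F.d_carrier[of n] G.d_carrier[of n]
    have "\<exists>W\<in>poly_mats X (\<beta>' (Suc n)) (\<beta> (Suc n)). d' (Suc n) * W = \<phi> * d (Suc n)"
    proof (rule G.lift)
      show "\<phi> * d (Suc n) \<in> poly_mats X (\<beta>' n) (\<beta> (Suc n))"
        using poly_mats_mult[OF \<phi> F.mats] .
      fix v :: "('a, 'b) mpoly vec" assume v: "v \<in> free_mod X (\<beta> (Suc n))"
      have "(\<phi> * d (Suc n)) *\<^sub>v v = \<phi> *\<^sub>v (d (Suc n) *\<^sub>v v)"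
        using car v by (intro assoc_mult_mat_vec) (auto simp: free_mod_def)
      then show "(\<phi> * d (Suc n)) *\<^sub>v v \<in> cycles X I \<beta>' \<epsilon>' d' n"
        using cyc[of "d (Suc n) *\<^sub>v v"] F.boundary_cycle[OF v] by (simp add: cF_def cG_def)
    qed
    then obtain W where W: "W \<in> poly_mats X (\<beta>' (Suc n)) (\<beta> (Suc n))" "d' (Suc n) * W = \<phi> * d (Suc n)"
      by blast
    have "W *\<^sub>v v \<in> cG (Suc n)" if "v \<in> cF (Suc n)" for v
    proof -
      have v: "v \<in> free_mod X (\<beta> (Suc n))" "d (Suc n) *\<^sub>v v = 0\<^sub>v (\<beta> n)"
        using that by (auto simp: cF_def cycles_def)
      then have vc: "v \<in> carrier_vec (\<beta> (Suc n))" by (simp add: free_mod_def)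
      have "d' (Suc n) *\<^sub>v (W *\<^sub>v v) = \<phi> *\<^sub>v (d (Suc n) *\<^sub>v v)"
        using assoc_mult_mat_vec[OF car(3) poly_matsD(1)[OF W(1)] vc]
          assoc_mult_mat_vec[OF car(1,2) vc] W(2) by simp
      also have "\<dots> = 0\<^sub>v (\<beta>' n)" using v car by auto
      finally show ?thesis using poly_mats_mult_vec[OF W(1) v(1)] by (simp add: cG_def cycles_def)
    qed
    then show ?thesis using W unfolding P_def by blast
  qed
  obtain \<phi> where "\<And>n. P n (\<phi> n)" "\<And>n. d' (Suc n) * \<phi> (Suc n) = \<phi> n * d (Suc n)"
    using dependent_nat_choice[of P "\<lambda>n \<phi> \<phi>'. d' (Suc n) * \<phi>' = \<phi> * d (Suc n)", OF base step]
    by blast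
  then show ?thesis by (intro that[of \<phi>]) (auto simp: P_def)
qed

section \<open>Minimal resolutions modulo the variables\<close>

abbreviation const_mat :: "('x, 'k::field) mpoly mat \<Rightarrow> 'k mat" where
  "const_mat \<equiv> map_mat (\<lambda>f. Poly_Mapping.lookup f 0)"

lemma const_mat_mult:
  "A \<in> carrier_mat r m \<Longrightarrow> B \<in> carrier_mat m c \<Longrightarrow> const_mat (A * B) = const_mat A * const_mat B"
  by (rule const_coeff.mat_hom_mult)

text \<open>An endomorphism of a minimal resolution that lifts the identity is homotopic to the identity,
  hence equal to it modulo the variables.
  The matrix \<open>A\<close> of the induction is the homotopy composed with the differential.\<close>

lemma (in poly_resolution) const_mat_self_map:
  assumes min: "\<And>i. const_mat (d (Suc i)) = 0\<^sub>m (\<beta> i) (\<beta> (Suc i))"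
    and \<theta>: "\<And>i. \<theta> i \<in> poly_mats X (\<beta> i) (\<beta> i)"
    and aug: "\<And>v. v \<in> free_mod X (\<beta> 0) \<Longrightarrow> \<epsilon> \<bullet> (\<theta> 0 *\<^sub>v v) - \<epsilon> \<bullet> v \<in> I"
    and comm: "\<And>i. d (Suc i) * \<theta> (Suc i) = \<theta> i * d (Suc i)"
  shows "const_mat (\<theta> i) = 1\<^sub>m (\<beta> i)"
proof -
  have carr: "\<theta> i \<in> carrier_mat (\<beta> i) (\<beta> i)" for i using \<theta> by (rule poly_matsD)
  have ex_A: "\<exists>A\<in>poly_mats X (\<beta> i) (\<beta> i). const_mat A = 0\<^sub>m (\<beta> i) (\<beta> i) \<and>
     A * d (Suc i) = 0\<^sub>m (\<beta> i) (\<beta> (Suc i)) \<and>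
     (\<forall>v\<in>free_mod X (\<beta> i). (\<theta> i - 1\<^sub>m (\<beta> i) - A) *\<^sub>v v \<in> cycles X I \<beta> \<epsilon> d i)" (is "?S i") for i
  proof (induction i)
    case 0
    have "(\<theta> 0 - 1\<^sub>m (\<beta> 0) - 0\<^sub>m (\<beta> 0) (\<beta> 0)) *\<^sub>v v \<in> cycles X I \<beta> \<epsilon> d 0"
      if v: "v \<in> free_mod X (\<beta> 0)" for v
    proof -
      have vc: "v \<in> carrier_vec (\<beta> 0)" "\<epsilon> \<in> carrier_vec (\<beta> 0)" using v eps by (auto simp: free_mod_def)
      have eq: "\<theta> 0 - 1\<^sub>m (\<beta> 0) - 0\<^sub>m (\<beta> 0) (\<beta> 0) = \<theta> 0 - 1\<^sub>m (\<beta> 0)"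
        using carr[of 0] by (intro eq_matI) auto
      have "(\<theta> 0 - 1\<^sub>m (\<beta> 0)) *\<^sub>v v = \<theta> 0 *\<^sub>v v - v"
        using carr[of 0] vc by (simp add: minus_mult_distrib_mat_vec)
      moreover have "\<epsilon> \<bullet> (\<theta> 0 *\<^sub>v v - v) = \<epsilon> \<bullet> (\<theta> 0 *\<^sub>v v) - \<epsilon> \<bullet> v"
        using carr[of 0] vc by (intro scalar_prod_minus_distrib) auto
      moreover have "\<theta> 0 - 1\<^sub>m (\<beta> 0) \<in> poly_mats X (\<beta> 0) (\<beta> 0)"
        using \<theta> by (intro poly_mats_diff poly_mats_one)
      ultimately show ?thesis
        using aug[OF v] poly_mats_mult_vec[of "\<theta> 0 - 1\<^sub>m (\<beta> 0)", OF _ v] unfolding eq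
        by (simp add: cycles_def)
    qed
    then show ?case using d_carrier[of 0]
      by (intro bexI[of _ "0\<^sub>m (\<beta> 0) (\<beta> 0)"]) (auto simp: poly_mats_zero)
  next
    case (Suc i)
    then obtain A where A: "A \<in> poly_mats X (\<beta> i) (\<beta> i)"
      "A * d (Suc i) = 0\<^sub>m (\<beta> i) (\<beta> (Suc i))"
      "\<And>v. v \<in> free_mod X (\<beta> i) \<Longrightarrow> (\<theta> i - 1\<^sub>m (\<beta> i) - A) *\<^sub>v v \<in> cycles X I \<beta> \<epsilon> d i"
      by blast
    have "\<theta> i - 1\<^sub>m (\<beta> i) - A \<in> poly_mats X (\<beta> i) (\<beta> i)"
      using \<theta> A by (intro poly_mats_diff poly_mats_one)
    \<comment> \<open>\<open>H\<close> is the next component of the homotopy.\<close>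
    then obtain H where H: "H \<in> poly_mats X (\<beta> (Suc i)) (\<beta> i)" "d (Suc i) * H = \<theta> i - 1\<^sub>m (\<beta> i) - A"
      using lift A(3) by blast
    note Hc = poly_matsD(1)[OF H(1)] and Ac = poly_matsD(1)[OF A(1)]
    note dc = d_carrier[of i] and dc' = d_carrier[of "Suc i"]
    define A' where "A' = H * d (Suc i)"
    have A': "A' \<in> poly_mats X (\<beta> (Suc i)) (\<beta> (Suc i))"
      unfolding A'_def using H(1) mats by (rule poly_mats_mult)
    note A'c = poly_matsD(1)[OF A']
    have "const_mat A' = const_mat H * const_mat (d (Suc i))"
      unfolding A'_def using Hc dc by (rule const_mat_mult)
    also have "\<dots> = 0\<^sub>m (\<beta> (Suc i)) (\<beta> (Suc i))" using Hc by (simp add: min)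
    finally have 1: "const_mat A' = 0\<^sub>m (\<beta> (Suc i)) (\<beta> (Suc i))" .
    have "A' * d (Suc (Suc i)) = H * (d (Suc i) * d (Suc (Suc i)))"
      unfolding A'_def using Hc dc dc' by (rule assoc_mult_mat)
    also have "\<dots> = 0\<^sub>m (\<beta> (Suc i)) (\<beta> (Suc (Suc i)))" using Hc by (simp add: d_square)
    finally have 2: "A' * d (Suc (Suc i)) = 0\<^sub>m (\<beta> (Suc i)) (\<beta> (Suc (Suc i)))" .
    define u where "u = \<theta> (Suc i) - 1\<^sub>m (\<beta> (Suc i)) - A'"
    have u: "u \<in> poly_mats X (\<beta> (Suc i)) (\<beta> (Suc i))"
      unfolding u_def using \<theta> A' by (intro poly_mats_diff poly_mats_one)
    \<comment> \<open>Since \<open>d * A' = (d * H) * d = (\<theta> - 1 - A) * d\<close> and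
      \<open>\<theta>\<close> is a chain map, all that remains of \<open>d * u\<close> is
      \<open>A * d\<close>, which is zero by the induction hypothesis.\<close>
    have du: "d (Suc i) * u = 0\<^sub>m (\<beta> i) (\<beta> (Suc i))"
    proof -
      have "d (Suc i) * u = d (Suc i) * (\<theta> (Suc i) - 1\<^sub>m (\<beta> (Suc i))) - d (Suc i) * A'"
        unfolding u_def using dc carr A'c by (intro mult_minus_distrib_mat) auto
      also have "d (Suc i) * (\<theta> (Suc i) - 1\<^sub>m (\<beta> (Suc i))) = \<theta> i * d (Suc i) - d (Suc i)"
        using dc carr[of "Suc i"] by (subst mult_minus_distrib_mat) (auto simp: comm)
      also have "d (Suc i) * A' = (d (Suc i) * H) * d (Suc i)"
        unfolding A'_def by (rule assoc_mult_mat[OF dc Hc dc, symmetric])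
      also have "\<dots> = (\<theta> i - 1\<^sub>m (\<beta> i)) * d (Suc i) - A * d (Suc i)"
        unfolding H(2) using carr Ac dc by (intro minus_mult_distrib_mat) auto
      also have "(\<theta> i - 1\<^sub>m (\<beta> i)) * d (Suc i) = \<theta> i * d (Suc i) - d (Suc i)"
        using minus_mult_distrib_mat[OF carr one_carrier_mat dc] left_mult_one_mat[OF dc] by simp
      finally show ?thesis unfolding A(2) using carr[of i] dc by auto
    qed
    have "u *\<^sub>v v \<in> cycles X I \<beta> \<epsilon> d (Suc i)" if v: "v \<in> free_mod X (\<beta> (Suc i))" for v
    proof -
      have vc: "v \<in> carrier_vec (\<beta> (Suc i))" using v by (simp add: free_mod_def)
      have "d (Suc i) *\<^sub>v (u *\<^sub>v v) = (d (Suc i) * u) *\<^sub>v v"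
        by (rule assoc_mult_mat_vec[OF dc poly_matsD(1)[OF u] vc, symmetric])
      also have "\<dots> = 0\<^sub>v (\<beta> i)" unfolding du using vc by (intro eq_vecI) auto
      finally show ?thesis using poly_mats_mult_vec[OF u v] by (simp add: cycles_def)
    qed
    then show ?case using A' 1 2 unfolding u_def by blast
  qed
  obtain A where A: "A \<in> poly_mats X (\<beta> i) (\<beta> i)" "const_mat A = 0\<^sub>m (\<beta> i) (\<beta> i)"
    "\<And>v. v \<in> free_mod X (\<beta> i) \<Longrightarrow> (\<theta> i - 1\<^sub>m (\<beta> i) - A) *\<^sub>v v \<in> cycles X I \<beta> \<epsilon> d i"
    using ex_A[of i] by blast
  have "\<theta> i - 1\<^sub>m (\<beta> i) - A \<in> poly_mats X (\<beta> i) (\<beta> i)"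
    using \<theta> A by (intro poly_mats_diff poly_mats_one)
  then obtain H where H: "H \<in> poly_mats X (\<beta> (Suc i)) (\<beta> i)" "d (Suc i) * H = \<theta> i - 1\<^sub>m (\<beta> i) - A"
    using lift A(3) by blast
  \<comment> \<open>\<open>\<theta> - 1 = A + d * H\<close>, and both \<open>A\<close> and
    \<open>d\<close> vanish modulo the variables.\<close>
  have "const_mat (d (Suc i) * H) = const_mat (d (Suc i)) * const_mat H"
    by (rule const_mat_mult[OF d_carrier poly_matsD(1)[OF H(1)]])
  also have "\<dots> = 0\<^sub>m (\<beta> i) (\<beta> i)" using poly_matsD(1)[OF H(1)] by (simp add: min)
  finally have z: "const_mat (\<theta> i - 1\<^sub>m (\<beta> i) - A) = 0\<^sub>m (\<beta> i) (\<beta> i)" unfolding H(2) .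
  show ?thesis
  proof (rule eq_matI)
    fix r c assume "r < dim_row (1\<^sub>m (\<beta> i) :: 'k mat)" "c < dim_col (1\<^sub>m (\<beta> i) :: 'k mat)"
    then have rc: "r < \<beta> i" "c < \<beta> i" by auto
    have "const_mat (\<theta> i - 1\<^sub>m (\<beta> i) - A) $$ (r, c) = 0" "const_mat A $$ (r, c) = 0"
      using z A(2) rc by auto
    then show "const_mat (\<theta> i) $$ (r, c) = 1\<^sub>m (\<beta> i) $$ (r, c)"
      using rc carr[of i] poly_matsD(1)[OF A(1)] by (auto simp: lookup_minus split: if_splits)
  qed (use carr in auto)
qed

text \<open>The composite of comparison maps in both directions is a self-map of the minimal
  resolution lifting the identity. Modulo the variables it is the identity, and it factors through a
  space of dimension \<open>\<beta>' i\<close>.\<close>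

lemma minimal_rank_le:
  assumes F: "poly_resolution X I \<beta> \<epsilon> d" and G: "poly_resolution X I \<beta>' \<epsilon>' d'"
    and min: "\<And>i. const_mat (d (Suc i)) = 0\<^sub>m (\<beta> i) (\<beta> (Suc i))"
  shows "\<beta> i \<le> \<beta>' i"
proof -
  interpret F: poly_resolution X I \<beta> \<epsilon> d by (rule F)
  interpret G: poly_resolution X I \<beta>' \<epsilon>' d' by (rule G)
  obtain \<phi> where \<phi>: "\<And>i. \<phi> i \<in> poly_mats X (\<beta>' i) (\<beta> i)"
    "\<And>v. v \<in> free_mod X (\<beta> 0) \<Longrightarrow> \<epsilon>' \<bullet> (\<phi> 0 *\<^sub>v v) - \<epsilon> \<bullet> v \<in> I"
    "\<And>i. d' (Suc i) * \<phi> (Suc i) = \<phi> i * d (Suc i)" by (rule comparison_map[OF F G]) blast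
  obtain \<psi> where \<psi>: "\<And>i. \<psi> i \<in> poly_mats X (\<beta> i) (\<beta>' i)"
    "\<And>v. v \<in> free_mod X (\<beta>' 0) \<Longrightarrow> \<epsilon> \<bullet> (\<psi> 0 *\<^sub>v v) - \<epsilon>' \<bullet> v \<in> I"
    "\<And>i. d (Suc i) * \<psi> (Suc i) = \<psi> i * d' (Suc i)" by (rule comparison_map[OF G F]) blast
  note \<phi>c = poly_matsD(1)[OF \<phi>(1)] and \<psi>c = poly_matsD(1)[OF \<psi>(1)]
  have "const_mat (\<psi> i * \<phi> i) = 1\<^sub>m (\<beta> i)"
  proof (rule F.const_mat_self_map[OF min])
    show "\<psi> i * \<phi> i \<in> poly_mats X (\<beta> i) (\<beta> i)" for i by (rule poly_mats_mult[OF \<psi>(1) \<phi>(1)])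
    show "\<epsilon> \<bullet> (\<psi> 0 * \<phi> 0 *\<^sub>v v) - \<epsilon> \<bullet> v \<in> I" if v: "v \<in> free_mod X (\<beta> 0)" for v
    proof -
      have "\<psi> 0 * \<phi> 0 *\<^sub>v v = \<psi> 0 *\<^sub>v (\<phi> 0 *\<^sub>v v)"
        using v by (intro assoc_mult_mat_vec[OF \<psi>c \<phi>c]) (simp add: free_mod_def)
      then show ?thesis
        using mpoly_idealD(3)[OF F.ideal \<psi>(2)[OF poly_mats_mult_vec[OF \<phi>(1) v]] \<phi>(2)[OF v]] by simp
    qed
    show "d (Suc i) * (\<psi> (Suc i) * \<phi> (Suc i)) = \<psi> i * \<phi> i * d (Suc i)" for i
    proof -
      have "d (Suc i) * (\<psi> (Suc i) * \<phi> (Suc i)) = d (Suc i) * \<psi> (Suc i) * \<phi> (Suc i)"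
        by (rule assoc_mult_mat[OF F.d_carrier \<psi>c \<phi>c, symmetric])
      also have "\<dots> = \<psi> i * (d' (Suc i) * \<phi> (Suc i))"
        unfolding \<psi>(3) by (rule assoc_mult_mat[OF \<psi>c G.d_carrier \<phi>c])
      also have "\<dots> = \<psi> i * \<phi> i * d (Suc i)"
        unfolding \<phi>(3) by (rule assoc_mult_mat[OF \<psi>c \<phi>c F.d_carrier, symmetric])
      finally show ?thesis .
    qed
  qed
  then have "const_mat (\<psi> i) * const_mat (\<phi> i) = 1\<^sub>m (\<beta> i)"
    using const_mat_mult[OF \<psi>c \<phi>c] by simp
  then show ?thesis
    by (rule mult_eq_one_imp_dim_le[rotated 2]) (use \<phi>c \<psi>c in auto)
qed

lemma minimal_free_resolutionD:
  assumes "minimal_free_resolution X I \<beta> \<delta> \<epsilon> d" "mpoly_ideal X I"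
  shows "poly_resolution X I \<beta> \<epsilon> d" "const_mat (d (Suc i)) = 0\<^sub>m (\<beta> i) (\<beta> (Suc i))"
proof -
  have M: "multigraded_free_resolution X I \<beta> \<delta> \<epsilon> d"
    and min: "\<And>i f. f \<in> elements_mat (d (Suc i)) \<Longrightarrow> Poly_Mapping.lookup f 0 = 0"
    using assms by (auto simp: minimal_free_resolution_def)
  have dc: "d (Suc i) \<in> carrier_mat (\<beta> i) (\<beta> (Suc i))" "elements_mat (d (Suc i)) \<subseteq> mpolys X" for i
    using M by (auto simp: multigraded_free_resolution_def)
  have ex0: "{v \<in> free_mod X (\<beta> 0). \<epsilon> \<bullet> v \<in> I} = (\<lambda>w. d 1 *\<^sub>v w) ` free_mod X (\<beta> 1)"
    and exS: "\<And>i. {v \<in> free_mod X (\<beta> (Suc i)). d (Suc i) *\<^sub>v v = 0\<^sub>v (\<beta> i)} =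
          (\<lambda>w. d (Suc (Suc i)) *\<^sub>v w) ` free_mod X (\<beta> (Suc (Suc i)))"
    using M by (simp_all add: multigraded_free_resolution_def)
  show "poly_resolution X I \<beta> \<epsilon> d"
  proof
    show "mpoly_ideal X I" by fact
    show "\<epsilon> \<in> free_mod X (\<beta> 0)" using M by (simp add: multigraded_free_resolution_def)
    show "d (Suc i) \<in> poly_mats X (\<beta> i) (\<beta> (Suc i))" for i
      using dc[of i] by (auto simp: poly_mats_def)
    show "\<exists>v\<in>free_mod X (\<beta> 0). f - \<epsilon> \<bullet> v \<in> I" if "f \<in> mpolys X" for f
      using M that by (simp add: multigraded_free_resolution_def)
    show "cycles X I \<beta> \<epsilon> d i = (\<lambda>w. d (Suc i) *\<^sub>v w) ` free_mod X (\<beta> (Suc i))" for i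
      using ex0 exS by (cases i) (simp_all add: cycles_def)
  qed
  show "const_mat (d (Suc i)) = 0\<^sub>m (\<beta> i) (\<beta> (Suc i))"
    using dc[of i] min[of _ i] by (intro eq_matI) auto
qed

text \<open>The rank inequality applies in both directions to two minimal resolutions, so the
  definite description is determined by any one of them.\<close>

lemma betti_number_eqI:
  assumes I: "mpoly_ideal X I" and M: "minimal_free_resolution X I \<beta> \<delta> \<epsilon> d"
  shows "betti_number X I i = \<beta> i"
  unfolding betti_number_def
proof (rule the_equality)
  show "\<exists>\<beta>' \<delta> \<epsilon> d. minimal_free_resolution X I \<beta>' \<delta> \<epsilon> d \<and> \<beta>' i = \<beta> i" using M by blast
  fix r assume "\<exists>\<beta> \<delta> \<epsilon> d. minimal_free_resolution X I \<beta> \<delta> \<epsilon> d \<and> \<beta> i = r"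
  then obtain \<beta>' \<delta>' \<epsilon>' d' where M': "minimal_free_resolution X I \<beta>' \<delta>' \<epsilon>' d'" "\<beta>' i = r" by blast
  note F = minimal_free_resolutionD[OF M I] and G = minimal_free_resolutionD[OF M'(1) I]
  have "\<beta> i \<le> \<beta>' i" by (rule minimal_rank_le[OF F(1) G(1) F(2)])
  moreover have "\<beta>' i \<le> \<beta> i" by (rule minimal_rank_le[OF G(1) F(1) G(2)])
  ultimately show "r = \<beta> i" using M'(2) by simp
qed

section \<open>Squarefree complexes of scalars\<close>

text \<open>\<open>h\<close> is the homological degree, and \<open>D s t\<close> is the coefficient, without the monomial
  \<open>\<Prod>x\<in>E t - E s. x\<close>, of \<open>s\<close> in the differential of \<open>t\<close>.  Homological degree \<open>0\<close> is exempt from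
  exactness.\<close>

definition sqf_resolution ::
  "'g set \<Rightarrow> ('g \<Rightarrow> nat) \<Rightarrow> ('g \<Rightarrow> 'x set) \<Rightarrow> ('g \<Rightarrow> 'g \<Rightarrow> 'k::field) \<Rightarrow> bool" where
  "sqf_resolution C h E D \<longleftrightarrow> finite C \<and>
     (\<forall>s\<in>C. \<forall>t\<in>C. D s t \<noteq> 0 \<longrightarrow> h t = Suc (h s) \<and> E s \<subseteq> E t) \<and>
     (\<forall>r\<in>C. \<forall>t\<in>C. (\<Sum>s\<in>C. D r s * D s t) = 0) \<and>
     (\<forall>A z. (\<forall>s\<in>C. z s \<noteq> 0 \<longrightarrow> 0 < h s \<and> E s \<subseteq> A) \<and> (\<forall>r\<in>C. (\<Sum>s\<in>C. D r s * z s) = 0) \<longrightarrow>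
        (\<exists>w. (\<forall>t\<in>C. w t \<noteq> 0 \<longrightarrow> E t \<subseteq> A) \<and> (\<forall>s\<in>C. z s = (\<Sum>t\<in>C. D s t * w t))))"

text \<open>Gaussian elimination at the entry \<open>D p q\<close>. As \<open>E p = E q\<close>, no
  monomial is attached to this entry, so it is a unit over the polynomial ring and the pair splits
  off as a trivial summand. \<open>D'\<close> is the Schur complement.\<close>

lemma cancel_pair:
  assumes R: "sqf_resolution C h E D"
    and pq: "p \<in> C" "q \<in> C" "D p q \<noteq> 0" "E p = E q" "0 < h p"
  defines "D' \<equiv> \<lambda>s t. D s t - D s q * D p t / D p q"
  shows "sqf_resolution (C - {p, q}) h E D'"
proof -
  define C' where "C' = C - {p, q}"
  note R' = R[unfolded sqf_resolution_def]
  have fin: "finite C" using R' by simp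
  have deg: "h t = Suc (h s) \<and> E s \<subseteq> E t" if "s \<in> C" "t \<in> C" "D s t \<noteq> 0" for s t
    using R' that by simp
  have dd: "(\<Sum>s\<in>C. D r s * D s t) = 0" if "r \<in> C" "t \<in> C" for r t
    using R' that by simp
  have ex: "\<exists>w. (\<forall>t\<in>C. w t \<noteq> 0 \<longrightarrow> E t \<subseteq> A) \<and> (\<forall>s\<in>C. z s = (\<Sum>t\<in>C. D s t * w t))"
    if "\<And>s. s \<in> C \<Longrightarrow> z s \<noteq> 0 \<Longrightarrow> 0 < h s \<and> E s \<subseteq> A"
      and "\<And>r. r \<in> C \<Longrightarrow> (\<Sum>s\<in>C. D r s * z s) = 0" for A z
    using conjunct2[OF conjunct2[OF conjunct2[OF R']], rule_format, of z A] that by simp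
  have hpq: "h q = Suc (h p)" using deg pq by blast
  have "p \<noteq> q" using hpq by auto
  \<comment> \<open>Column \<open>q\<close> and row \<open>p\<close> of \<open>D'\<close> vanish, so
    sums over \<open>C'\<close> of products of \<open>D'\<close> can be extended to
    \<open>C\<close>.\<close>
  have D'q: "D' s q = 0" for s using pq by (simp add: D'_def)
  have D'p: "D' p t = 0" for t using pq by (simp add: D'_def)
  have split: "(\<Sum>s\<in>C. f s) = (\<Sum>s\<in>C'. f s) + f p + f q" for f :: "_ \<Rightarrow> 'c"
  proof -
    have "C = insert p (insert q C')" using pq by (auto simp: C'_def)
    moreover have "p \<notin> insert q C'" "q \<notin> C'" "finite C'"
      using fin \<open>p \<noteq> q\<close> by (auto simp: C'_def)
    ultimately show ?thesis by (simp add: add_ac)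
  qed
  have fin': "finite C'" using fin by (simp add: C'_def)
  have sub: "C' \<subseteq> C" by (auto simp: C'_def)
  have deg': "h t = Suc (h s) \<and> E s \<subseteq> E t" if "s \<in> C'" "t \<in> C'" "D' s t \<noteq> 0" for s t
  proof (cases "D s t = 0")
    case True
    then have "D s q \<noteq> 0" "D p t \<noteq> 0" using that by (auto simp: D'_def)
    moreover have "s \<in> C" "t \<in> C" using that sub by auto
    ultimately show ?thesis using deg[of s q] deg[of p t] pq hpq by auto
  qed (use deg that sub in auto)
  have dd': "(\<Sum>s\<in>C'. D' r s * D' s t) = 0" if "r \<in> C'" "t \<in> C'" for r t
  proof -
    have rt: "r \<in> C" "t \<in> C" using that sub by auto
    define c where "c = D p t / D p q"
    define e where "e = D r q / D p q"
    have "(\<Sum>s\<in>C'. D' r s * D' s t) = (\<Sum>s\<in>C. D' r s * D' s t)"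
      by (simp add: split D'q D'p)
    also have "\<dots> = (\<Sum>s\<in>C. D r s * D s t - D r s * D s q * c - e * (D p s * D s t) + e * (D p s * D s q) * c)"
      by (simp add: D'_def c_def e_def algebra_simps)
    also have "\<dots> = (\<Sum>s\<in>C. D r s * D s t) - (\<Sum>s\<in>C. D r s * D s q) * c
        - e * (\<Sum>s\<in>C. D p s * D s t) + e * (\<Sum>s\<in>C. D p s * D s q) * c"
      by (simp add: sum.distrib sum_subtractf sum_distrib_left sum_distrib_right)
    also have "\<dots> = 0"
      using dd[OF rt] dd[OF rt(1) pq(2)] dd[OF pq(1) rt(2)] dd[OF pq(1,2)] by simp
    finally show ?thesis .
  qed
  have ex': "\<exists>w. (\<forall>t\<in>C'. w t \<noteq> 0 \<longrightarrow> E t \<subseteq> A) \<and> (\<forall>s\<in>C'. z s = (\<Sum>t\<in>C'. D' s t * w t))"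
    if z: "\<And>s. s \<in> C' \<Longrightarrow> z s \<noteq> 0 \<Longrightarrow> 0 < h s \<and> E s \<subseteq> A"
      and cyc: "\<And>r. r \<in> C' \<Longrightarrow> (\<Sum>s\<in>C'. D' r s * z s) = 0" for A z
  proof -
    define y where "y = (\<Sum>s\<in>C'. D p s * z s)"
    \<comment> \<open>Extends \<open>z\<close> to a cycle of the old complex: the value at
      \<open>q\<close> is chosen to make the \<open>p\<close>-component of the boundary
      vanish.\<close>
    define z' where "z' = (\<lambda>s. if s = p then 0 else if s = q then - y / D p q else z s)"
    have z'C: "z' s = z s" if "s \<in> C'" for s using that by (auto simp: z'_def C'_def)
    have z'p: "z' p = 0" and z'q: "z' q = - y / D p q" using \<open>p \<noteq> q\<close> by (auto simp: z'_def)
    have sum': "(\<Sum>s\<in>C. D r s * z' s) = (\<Sum>s\<in>C'. D r s * z s) - D r q * y / D p q" for r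
    proof -
      have "(\<Sum>s\<in>C'. D r s * z' s) = (\<Sum>s\<in>C'. D r s * z s)"
        by (rule sum.cong) (auto simp: z'C)
      then show ?thesis by (simp add: split z'p z'q)
    qed
    have cyc1: "(\<Sum>s\<in>C. D r s * z' s) = 0" if "r \<in> C'" for r
    proof -
      have "(\<Sum>s\<in>C'. D' r s * z s) = (\<Sum>s\<in>C'. D r s * z s) - D r q * y / D p q"
        by (simp add: D'_def y_def left_diff_distrib sum_subtractf sum_distrib_left sum_divide_distrib mult.assoc)
      then show ?thesis using cyc[OF that] sum' by simp
    qed
    have cyc2: "(\<Sum>s\<in>C. D p s * z' s) = 0"
      using sum'[of p] pq by (simp add: y_def)
    \<comment> \<open>All components of the boundary of \<open>z'\<close> other than the one at
      \<open>q\<close> are zero already. Applying row \<open>p\<close> of \<open>D\<close> and using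
      that \<open>D\<close> squares to zero leaves \<open>D p q\<close> times the one at
      \<open>q\<close>.\<close>
    have cyc3: "(\<Sum>s\<in>C. D q s * z' s) = 0"
    proof -
      have "0 = (\<Sum>s\<in>C. (\<Sum>r\<in>C. D p r * D r s) * z' s)"
        using dd pq by simp
      also have "\<dots> = (\<Sum>r\<in>C. D p r * (\<Sum>s\<in>C. D r s * z' s))"
        unfolding sum_distrib_right sum_distrib_left
        by (subst sum.swap) (simp add: mult.assoc)
      also have "\<dots> = (\<Sum>r\<in>C'. D p r * (\<Sum>s\<in>C. D r s * z' s)) + D p q * (\<Sum>s\<in>C. D q s * z' s)"
        by (subst split[of "\<lambda>r. D p r * (\<Sum>s\<in>C. D r s * z' s)"]) (simp add: cyc2)
      also have "(\<Sum>r\<in>C'. D p r * (\<Sum>s\<in>C. D r s * z' s)) = 0"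
        using cyc1 by simp
      finally show ?thesis using pq by simp
    qed
    \<comment> \<open>If \<open>z'\<close> is nonzero at \<open>q\<close>, then some
      \<open>t\<close> has \<open>D p t\<close> and \<open>z t\<close> nonzero, whence
      \<open>E q = E p \<subseteq> E t \<subseteq> A\<close>. This is where equality of the two sets
      keeps the new cycle in the strand.\<close>
    have supp: "0 < h s \<and> E s \<subseteq> A" if "s \<in> C" "z' s \<noteq> 0" for s
    proof (cases "s = q")
      case True
      then have "y \<noteq> 0" using that z'q by auto
      then obtain t where t: "t \<in> C'" "D p t * z t \<noteq> 0"
        unfolding y_def by (rule sum.not_neutral_contains_not_neutral)
      then have "t \<in> C" "D p t \<noteq> 0" "z t \<noteq> 0" using sub by auto
      then show ?thesis using z[OF t(1)] deg[OF pq(1)] True hpq pq(4) by auto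
    next
      case False
      then have "s \<in> C'" "z s \<noteq> 0" using that z'p by (auto simp: C'_def z'_def split: if_splits)
      then show ?thesis using z by blast
    qed
    have "\<exists>w. (\<forall>t\<in>C. w t \<noteq> 0 \<longrightarrow> E t \<subseteq> A) \<and> (\<forall>s\<in>C. z' s = (\<Sum>t\<in>C. D s t * w t))"
    proof (rule ex)
      show "\<And>s. s \<in> C \<Longrightarrow> z' s \<noteq> 0 \<Longrightarrow> 0 < h s \<and> E s \<subseteq> A" by (rule supp)
      show "(\<Sum>s\<in>C. D r s * z' s) = 0" if "r \<in> C" for r
        using that cyc1 cyc2 cyc3 by (cases "r \<in> C'") (auto simp: C'_def)
    qed
    then obtain w where w: "\<And>t. t \<in> C \<Longrightarrow> w t \<noteq> 0 \<Longrightarrow> E t \<subseteq> A"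
      "\<And>s. s \<in> C \<Longrightarrow> z' s = (\<Sum>t\<in>C. D s t * w t)" by blast
    \<comment> \<open>Subtracts a multiple of the boundary of \<open>q\<close>. This leaves the
      boundary of \<open>w\<close> unchanged and makes the coefficient at \<open>p\<close> zero; the
      one at \<open>q\<close> is killed by \<open>D'\<close>.\<close>
    define w' where "w' = (\<lambda>t. w t - D t q * (w p / D p q))"
    have "E t \<subseteq> A" if t: "t \<in> C" "w' t \<noteq> 0" for t
    proof (cases "w t = 0")
      case True
      then have "D t q \<noteq> 0" "w p \<noteq> 0" using t by (auto simp: w'_def)
      then show ?thesis using deg[of t q] w(1)[of p] pq t by auto
    qed (use w t in auto)
    moreover have "z s = (\<Sum>t\<in>C'. D' s t * w' t)" if s: "s \<in> C'" for s
    proof -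
      have dw: "(\<Sum>t\<in>C. D r t * w' t) = z' r" if "r \<in> C" for r
      proof -
        have "(\<Sum>t\<in>C. D r t * w' t) = (\<Sum>t\<in>C. D r t * w t) - (\<Sum>t\<in>C. D r t * D t q) * (w p / D p q)"
          by (simp add: w'_def right_diff_distrib sum_subtractf sum_distrib_right sum_divide_distrib mult.assoc)
        then show ?thesis using dd[of r q] that pq w(2) by simp
      qed
      have w'p: "w' p = 0" using pq by (simp add: w'_def)
      have "(\<Sum>t\<in>C'. D' s t * w' t) = (\<Sum>t\<in>C. D' s t * w' t)"
        by (simp add: split D'q w'p)
      also have "\<dots> = (\<Sum>t\<in>C. D s t * w' t) - (D s q / D p q) * (\<Sum>t\<in>C. D p t * w' t)"
        by (simp add: D'_def left_diff_distrib sum_subtractf sum_distrib_left mult.assoc)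
      also have "\<dots> = z s"
        using dw[of s] dw[of p] s sub pq z'C[OF s] z'p by auto
      finally show ?thesis by simp
    qed
    ultimately show ?thesis using sub by blast
  qed
  show ?thesis
    unfolding sqf_resolution_def C'_def[symmetric]
  proof (intro conjI)
    show "finite C'" by (rule fin')
    show "\<forall>s\<in>C'. \<forall>t\<in>C'. D' s t \<noteq> 0 \<longrightarrow> h t = Suc (h s) \<and> E s \<subseteq> E t" using deg' by blast
    show "\<forall>r\<in>C'. \<forall>t\<in>C'. (\<Sum>s\<in>C'. D' r s * D' s t) = 0" using dd' by blast
  qed (intro allI impI, erule conjE, rule ex', blast+)
qed

text \<open>Cancel pairs with equal sets until none is left; each cancellation lowers the number of
  generators. As degrees below \<open>k\<close> are reduced from the start, every cancelled pair
  lies in degrees \<open>\<ge> k\<close>.\<close>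

lemma ex_reduced_resolution:
  assumes "sqf_resolution C h E D" "0 < k"
    and "\<And>s t. \<lbrakk>s \<in> C; t \<in> C; h s < k; D s t \<noteq> 0\<rbrakk> \<Longrightarrow> E s \<noteq> E t"
  shows "\<exists>C' D'. sqf_resolution C' h E D' \<and> C' \<subseteq> C \<and> {s \<in> C'. h s < k} = {s \<in> C. h s < k} \<and>
    (\<forall>s\<in>C'. \<forall>t\<in>C'. h s < k \<longrightarrow> D' s t = D s t) \<and>
    (\<forall>s\<in>C'. \<forall>t\<in>C'. D' s t \<noteq> 0 \<longrightarrow> E s \<noteq> E t)"
  using assms
proof (induction "card C" arbitrary: C D rule: less_induct)
  case less
  note R = less.prems(1)
  show ?case
  proof (cases "\<forall>s\<in>C. \<forall>t\<in>C. D s t \<noteq> 0 \<longrightarrow> E s \<noteq> E t")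
    case True
    then show ?thesis using R by (intro exI[of _ C] exI[of _ D]) auto
  next
    case False
    then obtain p q where pq: "p \<in> C" "q \<in> C" "D p q \<noteq> 0" "E p = E q" by blast
    then have hp: "k \<le> h p" using less.prems(3)[OF pq(1,2) _ pq(3)] by (cases "h p < k") auto
    have fin: "finite C" using R by (simp add: sqf_resolution_def)
    have deg: "h t = Suc (h s)" if "s \<in> C" "t \<in> C" "D s t \<noteq> 0" for s t
      using R that by (simp add: sqf_resolution_def)
    define C' where "C' = C - {p, q}"
    define D' where "D' = (\<lambda>s t. D s t - D s q * D p t / D p q)"
    have R': "sqf_resolution C' h E D'"
      unfolding C'_def D'_def using cancel_pair[OF R pq] hp \<open>0 < k\<close> by simp
    have card: "card C' < card C"
      unfolding C'_def using fin pq by (intro psubset_card_mono) auto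
    \<comment> \<open>A change of the entry would require \<open>D s q \<noteq> 0\<close>, hence
      \<open>h s = h p \<ge> k\<close>.\<close>
    have D': "D' s t = D s t" if "s \<in> C" "h s < k" for s t
      using deg[of s q] deg[of p q] pq that hp by (auto simp: D'_def)
    have "\<exists>C'' D''. sqf_resolution C'' h E D'' \<and> C'' \<subseteq> C' \<and> {s \<in> C''. h s < k} = {s \<in> C'. h s < k} \<and>
      (\<forall>s\<in>C''. \<forall>t\<in>C''. h s < k \<longrightarrow> D'' s t = D' s t) \<and>
      (\<forall>s\<in>C''. \<forall>t\<in>C''. D'' s t \<noteq> 0 \<longrightarrow> E s \<noteq> E t)"
      using less.hyps[OF card R' \<open>0 < k\<close>] less.prems(3) D' by (auto simp: C'_def)
    then obtain C'' D'' where C'': "sqf_resolution C'' h E D''" "C'' \<subseteq> C'"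
      "{s \<in> C''. h s < k} = {s \<in> C'. h s < k}"
      "\<forall>s\<in>C''. \<forall>t\<in>C''. h s < k \<longrightarrow> D'' s t = D' s t"
      "\<forall>s\<in>C''. \<forall>t\<in>C''. D'' s t \<noteq> 0 \<longrightarrow> E s \<noteq> E t" by blast
    have "{s \<in> C'. h s < k} = {s \<in> C. h s < k}"
      using hp deg[of p q] pq by (auto simp: C'_def)
    moreover have "C'' \<subseteq> C" using C''(2) by (auto simp: C'_def)
    moreover have "\<forall>s\<in>C''. \<forall>t\<in>C''. h s < k \<longrightarrow> D'' s t = D s t"
      using C''(4) D' \<open>C'' \<subseteq> C\<close> by auto
    ultimately show ?thesis using C'' by (intro exI[of _ C''] exI[of _ D'']) simp
  qed
qed

section \<open>The Taylor complex\<close>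

definition taylor_sign :: "nat set \<Rightarrow> nat \<Rightarrow> 'k::field" where
  "taylor_sign s j = (- 1) ^ card {i \<in> s. i < j}"

text \<open>The incidence number of the face \<open>s\<close> in the simplex \<open>t\<close>, i.e.
  the coefficient of the Taylor differential without its monomial.\<close>

definition taylor_diff :: "nat set \<Rightarrow> nat set \<Rightarrow> 'k::field" where
  "taylor_diff s t = (if s \<subseteq> t \<and> card (t - s) = 1 then taylor_sign s (the_elem (t - s)) else 0)"

lemma taylor_sign_neq_0 [simp]: "taylor_sign s j \<noteq> 0"
  by (simp add: taylor_sign_def)

lemma taylor_sign_insert:
  assumes "finite s" "a \<notin> s"
  shows "taylor_sign (insert a s) b = (if a < b then - taylor_sign s b else taylor_sign s b)"
proof -
  have "{i \<in> insert a s. i < b} = (if a < b then insert a {i \<in> s. i < b} else {i \<in> s. i < b})"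
    by auto
  then show ?thesis using assms by (simp add: taylor_sign_def)
qed

lemma taylor_diff_insert: "j \<notin> s \<Longrightarrow> taylor_diff s (insert j s) = taylor_sign s j"
  by (auto simp: taylor_diff_def insert_Diff_if)

lemma taylor_diff_neq_0D:
  assumes "taylor_diff s t \<noteq> 0"
  obtains j where "j \<notin> s" "t = insert j s"
proof -
  have "s \<subseteq> t" "card (t - s) = 1" using assms by (auto simp: taylor_diff_def split: if_splits)
  then obtain j where "t - s = {j}" by (auto simp: card_1_singleton_iff)
  then have "j \<notin> s" "t = insert j s" using \<open>s \<subseteq> t\<close> by auto
  then show ?thesis by (rule that)
qed

lemma sum_taylor_diff:
  assumes "finite I" "s \<subseteq> I"
  shows "(\<Sum>t\<in>Pow I. taylor_diff s t * (w t :: 'a::field)) = (\<Sum>j\<in>I - s. taylor_sign s j * w (insert j s))"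
proof -
  have "(\<Sum>t\<in>Pow I. taylor_diff s t * w t) = (\<Sum>t\<in>(\<lambda>j. insert j s) ` (I - s). taylor_diff s t * w t)"
  proof (rule sum.mono_neutral_right)
    show "finite (Pow I)" using assms by simp
    show "(\<lambda>j. insert j s) ` (I - s) \<subseteq> Pow I" using assms by auto
    show "\<forall>t\<in>Pow I - (\<lambda>j. insert j s) ` (I - s). taylor_diff s t * w t = 0"
    proof
      fix t assume t: "t \<in> Pow I - (\<lambda>j. insert j s) ` (I - s)"
      have "taylor_diff s t = (0 :: 'a)"
      proof (rule ccontr)
        assume "taylor_diff s t \<noteq> (0 :: 'a)"
        then obtain j where "j \<notin> s" "t = insert j s" by (rule taylor_diff_neq_0D)
        then show False using t by auto
      qed
      then show "taylor_diff s t * w t = 0" by simp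
    qed
  qed
  also have "\<dots> = (\<Sum>j\<in>I - s. taylor_diff s (insert j s) * w (insert j s))"
    by (subst sum.reindex) (auto simp: inj_on_def)
  also have "\<dots> = (\<Sum>j\<in>I - s. taylor_sign s j * w (insert j s))"
    by (intro sum.cong) (auto simp: taylor_diff_insert)
  finally show ?thesis .
qed

text \<open>A nonzero term needs \<open>t\<close> to arise from \<open>r\<close> by adding two
  indices \<open>a < b\<close>. The two orders of adding them give opposite signs: inserting
  \<open>a\<close> first flips the sign of \<open>b\<close>, inserting \<open>b\<close> first does
  not affect that of \<open>a\<close>.\<close>

lemma taylor_diff_square:
  assumes "finite I" "r \<subseteq> I" "t \<subseteq> I"
  shows "(\<Sum>s\<in>Pow I. taylor_diff r s * taylor_diff s t) = (0 :: 'k::field)"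
proof -
  have fin: "finite r" using assms finite_subset by blast
  have eq: "(\<Sum>s\<in>Pow I. taylor_diff r s * taylor_diff s t) =
      (\<Sum>j\<in>I - r. taylor_sign r j * (taylor_diff (insert j r) t :: 'k))"
    by (rule sum_taylor_diff[OF assms(1,2)])
  show ?thesis
  proof (cases "\<exists>a b. a < b \<and> a \<notin> r \<and> b \<notin> r \<and> t = insert a (insert b r)")
    case True
    then obtain a b where ab: "a < b" "a \<notin> r" "b \<notin> r" "t = insert a (insert b r)" by blast
    have "(\<Sum>j\<in>I - r. taylor_sign r j * (taylor_diff (insert j r) t :: 'k)) =
        (\<Sum>j\<in>{a, b}. taylor_sign r j * taylor_diff (insert j r) t)"
    proof (rule sum.mono_neutral_right)
      show "\<forall>j\<in>I - r - {a, b}. taylor_sign r j * (taylor_diff (insert j r) t :: 'k) = 0"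
        using ab by (auto simp: taylor_diff_def)
    qed (use assms ab in auto)
    also have "(\<Sum>j\<in>{a, b}. taylor_sign r j * taylor_diff (insert j r) t) =
       taylor_sign r a * taylor_sign (insert a r) b + (taylor_sign r b * taylor_sign (insert b r) a :: 'k)"
    proof -
      have "taylor_diff (insert a r) t = (taylor_sign (insert a r) b :: 'k)"
        using taylor_diff_insert[of b "insert a r"] ab by (simp add: insert_commute)
      moreover have "taylor_diff (insert b r) t = (taylor_sign (insert b r) a :: 'k)"
        using taylor_diff_insert[of a "insert b r"] ab by simp
      ultimately show ?thesis using ab by simp
    qed
    also have "\<dots> = 0" using ab fin by (simp add: taylor_sign_insert)
    finally show ?thesis using eq by simp
  next
    case False
    have "taylor_diff (insert j r) t = (0 :: 'k)" if "j \<in> I - r" for j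
    proof (rule ccontr)
      assume "taylor_diff (insert j r) t \<noteq> (0 :: 'k)"
      then obtain k where "k \<notin> insert j r" "t = insert k (insert j r)"
        by (rule taylor_diff_neq_0D)
      then show False using False that by (metis DiffD2 insertCI insert_commute nat_neq_iff)
    qed
    then show ?thesis using eq by simp
  qed
qed

text \<open>A strand of the Taylor complex is the augmented chain complex of a full simplex, which is
  contracted by the cone over its least vertex; for this vertex all signs are positive.\<close>

lemma taylor_resolution:
  assumes I: "finite I"
  shows "sqf_resolution (Pow I) card (\<lambda>s. \<Union>i\<in>s. G i) (taylor_diff :: _ \<Rightarrow> _ \<Rightarrow> 'k::field)"
  unfolding sqf_resolution_def
proof (intro conjI ballI allI impI)
  show "finite (Pow I)" using I by simp
next
  fix s t assume st: "s \<in> Pow I" "t \<in> Pow I" "taylor_diff s t \<noteq> (0 :: 'k)"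
  then have "finite s" using I finite_subset by blast
  then show "card t = Suc (card s)" using st(3) by (auto elim: taylor_diff_neq_0D)
  show "(\<Union>i\<in>s. G i) \<subseteq> (\<Union>i\<in>t. G i)" using st(3) by (auto elim: taylor_diff_neq_0D)
next
  fix r t assume "r \<in> Pow I" "t \<in> Pow I"
  then show "(\<Sum>s\<in>Pow I. taylor_diff r s * taylor_diff s t) = (0 :: 'k)"
    using taylor_diff_square[OF I] by auto
next
  fix A and z :: "nat set \<Rightarrow> 'k"
  assume *: "(\<forall>s\<in>Pow I. z s \<noteq> 0 \<longrightarrow> 0 < card s \<and> (\<Union>i\<in>s. G i) \<subseteq> A) \<and>
    (\<forall>r\<in>Pow I. (\<Sum>s\<in>Pow I. taylor_diff r s * z s) = 0)"
  \<comment> \<open>The strand at \<open>A\<close> consists of the subsets of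
    \<open>J\<close>.\<close>
  define J where "J = {i \<in> I. G i \<subseteq> A}"
  have finJ: "finite J" "J \<subseteq> I" using I by (auto simp: J_def)
  have zJ: "s \<subseteq> J" "s \<noteq> {}" if "s \<subseteq> I" "z s \<noteq> 0" for s
    using * that by (auto simp: J_def)
  have cyc: "(\<Sum>j\<in>I - r. taylor_sign r j * z (insert j r)) = 0" if "r \<subseteq> I" for r
    using * that sum_taylor_diff[OF I that, of z] by auto
  show "\<exists>w. (\<forall>t\<in>Pow I. w t \<noteq> 0 \<longrightarrow> (\<Union>i\<in>t. G i) \<subseteq> A) \<and>
      (\<forall>s\<in>Pow I. z s = (\<Sum>t\<in>Pow I. taylor_diff s t * w t))"
  proof (cases "J = {}")
    case True
    \<comment> \<open>Only the empty set remains in the strand, and \<open>z\<close> vanishes there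
      because it lives in positive degrees.\<close>
    then have "z s = 0" if "s \<subseteq> I" for s using zJ that by blast
    then show ?thesis by (intro exI[of _ "\<lambda>_. 0"]) auto
  next
    case False
    define m where "m = Min J"
    have mJ: "m \<in> J" and mle: "\<And>j. j \<in> J \<Longrightarrow> m \<le> j"
      using False finJ by (auto simp: m_def)
    have sgn_m: "taylor_sign s m = (1 :: 'k)" if "s \<subseteq> J" for s
    proof -
      have "{i \<in> s. i < m} = {}" using that mle by force
      then show ?thesis by (simp only: taylor_sign_def card.empty power_0)
    qed
    \<comment> \<open>The contraction: \<open>w\<close> is \<open>z\<close> coned off from the
      vertex \<open>m\<close>.\<close>
    define w where "w = (\<lambda>t. if m \<in> t \<and> t \<subseteq> J then z (t - {m}) else 0)"
    have "z s = (\<Sum>j\<in>I - s. taylor_sign s j * w (insert j s))" if s: "s \<subseteq> I" for s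
    proof (cases "s \<subseteq> J")
      case False
      then have "z s = 0" using zJ(1) s by blast
      moreover have "w (insert j s) = 0" for j using False by (simp add: w_def)
      ultimately show ?thesis by simp
    next
      case sJ: True
      show ?thesis
      proof (cases "m \<in> s")
        case False
        have "(\<Sum>j\<in>I - s. taylor_sign s j * w (insert j s)) = (\<Sum>j\<in>{m}. taylor_sign s j * w (insert j s))"
          using False I mJ finJ by (intro sum.mono_neutral_right) (auto simp: w_def)
        also have "\<dots> = z s" using False sJ mJ sgn_m[OF sJ] by (simp add: w_def)
        finally show ?thesis by simp
      next
        case True
        \<comment> \<open>The cycle condition at \<open>r\<close> expresses \<open>z s\<close> by
          the values at \<open>insert j r\<close>. The signs at \<open>s = insert m r\<close> are
          opposite to those at \<open>r\<close>, because \<open>m < j\<close>.\<close>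
        define r where "r = s - {m}"
        have s_r: "s = insert m r" "m \<notin> r" using True by (auto simp: r_def)
        have finr: "finite r" using sJ finJ finite_subset by (auto simp: r_def)
        have "r \<subseteq> I" "r \<subseteq> J" using s sJ by (auto simp: r_def)
        have "I - r = insert m (I - s)" using True s mJ finJ by (auto simp: r_def)
        moreover have "m \<notin> I - s" using True by simp
        ultimately have "(\<Sum>j\<in>I - r. taylor_sign r j * z (insert j r)) =
            taylor_sign r m * z (insert m r) + (\<Sum>j\<in>I - s. taylor_sign r j * z (insert j r))"
          using I sum.insert[of "I - s" m] by simp
        then have "z s + (\<Sum>j\<in>I - s. taylor_sign r j * z (insert j r)) = 0"
          using cyc[OF \<open>r \<subseteq> I\<close>] sgn_m[OF \<open>r \<subseteq> J\<close>] by (simp flip: s_r(1))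
        moreover have "(\<Sum>j\<in>I - s. taylor_sign s j * w (insert j s)) =
            (\<Sum>j\<in>I - s. - (taylor_sign r j * z (insert j r)))"
        proof (rule sum.cong)
          fix j assume j: "j \<in> I - s"
          show "taylor_sign s j * w (insert j s) = - (taylor_sign r j * z (insert j r))"
          proof (cases "j \<in> J")
            case True
            have "m < j" using mle[OF True] j \<open>m \<in> s\<close> by (cases "m = j") auto
            moreover have "insert j s - {m} = insert j r" using j \<open>m \<in> s\<close> by (auto simp: r_def)
            ultimately show ?thesis using True sJ \<open>m \<in> s\<close> s_r finr
              by (simp add: w_def taylor_sign_insert)
          next
            case False
            then have "z (insert j r) = 0" using zJ(1)[of "insert j r"] j \<open>r \<subseteq> I\<close> by auto
            then show ?thesis using False by (simp add: w_def)
          qed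
        qed simp
        ultimately show ?thesis by (metis sum_negf eq_neg_iff_add_eq_0)
      qed
    qed
    moreover have "(\<Union>i\<in>t. G i) \<subseteq> A" if "w t \<noteq> 0" for t
      using that by (auto simp: w_def J_def split: if_splits)
    ultimately show ?thesis using sum_taylor_diff[OF I, of _ w] by (intro exI[of _ w]) auto
  qed
qed

section \<open>From scalars to polynomials\<close>

definition sqf_monom :: "'x set \<Rightarrow> 'x monom" where
  "sqf_monom A = (\<Sum>x\<in>A. Poly_Mapping.single x 1)"

lemma lookup_sqf_monom:
  "finite A \<Longrightarrow> Poly_Mapping.lookup (sqf_monom A) x = (if x \<in> A then 1 else 0)"
  by (simp add: sqf_monom_def lookup_sum lookup_single when_def)

lemma keys_sqf_monom: "finite A \<Longrightarrow> Poly_Mapping.keys (sqf_monom A) = A"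
  by (auto simp: in_keys_iff lookup_sqf_monom split: if_splits)

lemma sqf_monom_empty [simp]: "sqf_monom {} = 0"
  by (simp add: sqf_monom_def)

lemma sqf_monom_Diff_add:
  "finite B \<Longrightarrow> A \<subseteq> B \<Longrightarrow> sqf_monom (B - A) + sqf_monom A = sqf_monom B"
  unfolding sqf_monom_def by (rule sum.subset_diff[symmetric])

lemma prod_mvar:
  "(\<Prod>x\<in>A. mvar x) = (Poly_Mapping.single (sqf_monom A) 1 :: ('x, 'k::field) mpoly)"
  by (induction A rule: infinite_finite_induct)
    (simp_all add: sqf_monom_def mvar_def mult_single)

lemma single_sum:
  "Poly_Mapping.single k (\<Sum>i\<in>S. f i) = (\<Sum>i\<in>S. Poly_Mapping.single k (f i))"
  by (induction S rule: infinite_finite_induct) (simp_all add: single_add)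

lemma lookup_single_mult:
  fixes f :: "('x, 'k::field) mpoly"
  shows "Poly_Mapping.lookup (Poly_Mapping.single m c * f) (m + q) = c * Poly_Mapping.lookup f q"
    and "(\<And>q. b \<noteq> m + q) \<Longrightarrow> Poly_Mapping.lookup (Poly_Mapping.single m c * f) b = 0"
proof -
  have *: "Poly_Mapping.lookup (Poly_Mapping.single m c * f) b
      = c * (\<Sum>q. Poly_Mapping.lookup f q when b = m + q)" for b
  proof -
    have "Poly_Mapping.lookup (Poly_Mapping.single m c * f) b =
      (\<Sum>l. Poly_Mapping.lookup (Poly_Mapping.single m c) l * (\<Sum>q. Poly_Mapping.lookup f q when b = l + q))"
      by (rule lookup_mult)
    also have "\<dots> = (\<Sum>l. c * (\<Sum>q. Poly_Mapping.lookup f q when b = m + q) when l = m)"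
      by (rule Sum_any.cong) (auto simp: lookup_single when_def)
    finally show ?thesis by simp
  qed
  show "Poly_Mapping.lookup (Poly_Mapping.single m c * f) (m + q) = c * Poly_Mapping.lookup f q"
  proof -
    have "(\<Sum>q'. Poly_Mapping.lookup f q' when m + q = m + q') =
        (\<Sum>q'. Poly_Mapping.lookup f q' when q' = q)"
      by (rule Sum_any.cong) (auto simp: when_def)
    then show ?thesis using *[of "m + q"] by simp
  qed
  show "Poly_Mapping.lookup (Poly_Mapping.single m c * f) b = 0" if "\<And>q. b \<noteq> m + q"
    using *[of b] that by (simp add: when_def)
qed

section \<open>Ideals generated by finitely many polynomials\<close>

lemma ring_mpoly_ring: "ring (mpoly_ring X :: ('x, 'k::field) mpoly ring)"
proof (rule ringI)
  show "abelian_group (mpoly_ring X :: ('x, 'k) mpoly ring)"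
  proof (rule abelian_groupI)
    fix f :: "('x, 'k) mpoly" assume "f \<in> carrier (mpoly_ring X)"
    then show "\<exists>g\<in>carrier (mpoly_ring X). g \<oplus>\<^bsub>mpoly_ring X\<^esub> f = \<zero>\<^bsub>mpoly_ring X\<^esub>"
      by (intro bexI[of _ "- f"]) (auto simp: mpoly_ring_def mpolys_uminus)
  qed (auto simp: mpoly_ring_def mpolys_add add_ac)
  show "Group.monoid (mpoly_ring X :: ('x, 'k) mpoly ring)"
    by (rule monoidI) (auto simp: mpoly_ring_def mpolys_mult mult.assoc)
qed (auto simp: mpoly_ring_def algebra_simps)

lemma ideal_mpoly_ringI:
  fixes I :: "('x, 'k::field) mpoly set"
  assumes "mpoly_ideal X I"
  shows "ideal I (mpoly_ring X)"
proof (rule idealI)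
  interpret R: ring "mpoly_ring X :: ('x, 'k) mpoly ring" by (rule ring_mpoly_ring)
  note I = mpoly_idealD[OF assms]
  show "ring (mpoly_ring X :: ('x, 'k) mpoly ring)" by (rule ring_mpoly_ring)
  show "subgroup I (add_monoid (mpoly_ring X))"
  proof (rule R.add.subgroupI)
    show "I \<subseteq> carrier (mpoly_ring X)" "I \<noteq> {}" using I by (auto simp: mpoly_ring_def)
    fix a b assume a: "a \<in> I"
    have "\<ominus>\<^bsub>mpoly_ring X\<^esub> a = - a"
      using a I(1) mpolys_uminus by (intro R.minus_equality) (auto simp: mpoly_ring_def)
    then show "\<ominus>\<^bsub>mpoly_ring X\<^esub> a \<in> I" using mpoly_ideal_uminus[OF assms a] by simp
    assume "b \<in> I"
    then show "a \<oplus>\<^bsub>mpoly_ring X\<^esub> b \<in> I" using I(3) a by (simp add: mpoly_ring_def)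
  qed
  fix a x :: "('x, 'k) mpoly" assume a: "a \<in> I" "x \<in> carrier (mpoly_ring X)"
  then show "x \<otimes>\<^bsub>mpoly_ring X\<^esub> a \<in> I" using I(4) by (simp add: mpoly_ring_def)
  then show "a \<otimes>\<^bsub>mpoly_ring X\<^esub> x \<in> I" by (simp add: mpoly_ring_def mult.commute)
qed

lemma mpoly_ideal_span:
  assumes "\<And>s. s \<in> S \<Longrightarrow> g s \<in> mpolys X"
  shows "mpoly_ideal X {\<Sum>s\<in>S. f s * g s | f. \<forall>s\<in>S. f s \<in> mpolys X}"
  unfolding mpoly_ideal_def
proof (intro conjI ballI)
  let ?J = "{\<Sum>s\<in>S. f s * g s | f. \<forall>s\<in>S. f s \<in> mpolys X}"
  show "?J \<subseteq> mpolys X" using assms by (auto intro!: mpolys_sum mpolys_mult)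
  show "0 \<in> ?J" by (intro CollectI exI[of _ "\<lambda>_. 0"]) simp
  fix a assume "a \<in> ?J"
  then obtain f where f: "a = (\<Sum>s\<in>S. f s * g s)" "\<forall>s\<in>S. f s \<in> mpolys X" by blast
  show "c * a \<in> ?J" if "c \<in> mpolys X" for c
    using f that by (intro CollectI exI[of _ "\<lambda>s. c * f s"])
      (auto simp: sum_distrib_left mult.assoc intro: mpolys_mult)
  fix b assume "b \<in> ?J"
  then obtain f' where f': "b = (\<Sum>s\<in>S. f' s * g s)" "\<forall>s\<in>S. f' s \<in> mpolys X" by blast
  show "a + b \<in> ?J"
    using f f' by (intro CollectI exI[of _ "\<lambda>s. f s + f' s"])
      (auto simp: sum.distrib distrib_right intro: mpolys_add)
qed

lemma genideal_mpoly_ring: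
  fixes g :: "'s \<Rightarrow> ('x, 'k::field) mpoly"
  assumes fin: "finite S" and g: "\<And>s. s \<in> S \<Longrightarrow> g s \<in> mpolys X"
  shows "Idl\<^bsub>mpoly_ring X\<^esub> (g ` S) = {\<Sum>s\<in>S. f s * g s | f. \<forall>s\<in>S. f s \<in> mpolys X}" (is "_ = ?J")
proof
  interpret R: ring "mpoly_ring X :: ('x, 'k) mpoly ring" by (rule ring_mpoly_ring)
  have "g ` S \<subseteq> ?J"
  proof (rule image_subsetI)
    fix s assume s: "s \<in> S"
    have "g s = (\<Sum>t\<in>S. (if t = s then 1 else 0) * g t)"
      using s fin by (simp add: if_distrib[of "\<lambda>x. x * _"] cong: if_cong)
    then show "g s \<in> ?J" by (intro CollectI exI[of _ "\<lambda>t. if t = s then 1 else 0"]) auto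
  qed
  then show "Idl\<^bsub>mpoly_ring X\<^esub> (g ` S) \<subseteq> ?J"
    using ideal_mpoly_ringI[OF mpoly_ideal_span[OF g]] by (intro R.genideal_minimal)
  have car: "g ` S \<subseteq> carrier (mpoly_ring X)" using g by (auto simp: mpoly_ring_def)
  interpret Id: ideal "Idl\<^bsub>mpoly_ring X\<^esub> (g ` S)" "mpoly_ring X"
    by (rule R.genideal_ideal[OF car])
  show "?J \<subseteq> Idl\<^bsub>mpoly_ring X\<^esub> (g ` S)"
  proof clarify
    fix f :: "'s \<Rightarrow> ('x, 'k) mpoly" assume f: "\<forall>s\<in>S. f s \<in> mpolys X"
    have "(\<Sum>s\<in>T. f s * g s) \<in> Idl\<^bsub>mpoly_ring X\<^esub> (g ` S)" if "finite T" "T \<subseteq> S" for T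
      using that
    proof (induction T rule: finite_induct)
      case empty
      show ?case using Id.zero_closed by (simp add: mpoly_ring_def)
    next
      case (insert s T)
      have "f s * g s \<in> Idl\<^bsub>mpoly_ring X\<^esub> (g ` S)"
        using Id.I_l_closed[of "g s" "f s"] R.genideal_self[OF car] f insert.prems
        by (auto simp: mpoly_ring_def)
      then show ?case using insert Id.a_closed[of "f s * g s"] by (simp add: mpoly_ring_def)
    qed
    then show "(\<Sum>s\<in>S. f s * g s) \<in> Idl\<^bsub>mpoly_ring X\<^esub> (g ` S)" using fin by blast
  qed
qed

text \<open>A scalar complex that is to be turned into a complex of free modules over the polynomial
  ring in \<open>X\<close>, the generator \<open>s\<close> sitting in multidegree
  \<open>sqf_monom (E s)\<close>.\<close>

locale squarefree_complex =
  fixes X :: "'x set" and C :: "'g set" and h :: "'g \<Rightarrow> nat" and E :: "'g \<Rightarrow> 'x set"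
    and D :: "'g \<Rightarrow> 'g \<Rightarrow> 'k::field"
  assumes res: "sqf_resolution C h E D"
    and finE: "s \<in> C \<Longrightarrow> finite (E s)" and subE: "s \<in> C \<Longrightarrow> E s \<subseteq> X"
begin

lemma finC: "finite C"
  using res by (simp add: sqf_resolution_def)

lemma degD: "\<lbrakk>s \<in> C; t \<in> C; D s t \<noteq> 0\<rbrakk> \<Longrightarrow> h t = Suc (h s) \<and> E s \<subseteq> E t"
  using res by (simp add: sqf_resolution_def)

lemma squareD: "\<lbrakk>r \<in> C; t \<in> C\<rbrakk> \<Longrightarrow> (\<Sum>s\<in>C. D r s * D s t) = 0"
  using res by (simp add: sqf_resolution_def)

lemma strand_exact:
  assumes "\<And>s. s \<in> C \<Longrightarrow> z s \<noteq> 0 \<Longrightarrow> 0 < h s \<and> E s \<subseteq> A"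
    and "\<And>r. r \<in> C \<Longrightarrow> (\<Sum>s\<in>C. D r s * z s) = 0"
  shows "\<exists>w. (\<forall>t\<in>C. w t \<noteq> 0 \<longrightarrow> E t \<subseteq> A) \<and> (\<forall>s\<in>C. z s = (\<Sum>t\<in>C. D s t * w t))"
  using conjunct2[OF conjunct2[OF conjunct2[OF res[unfolded sqf_resolution_def]]], rule_format, of z A]
    assms by simp

text \<open>The monomial factor makes the differential homogeneous for the multidegrees of the
  generators.\<close>

definition dmon :: "'g \<Rightarrow> 'g \<Rightarrow> ('x, 'k) mpoly" where
  "dmon s t = Poly_Mapping.single (sqf_monom (E t - E s)) (D s t)"

lemma dmon_mpolys: "t \<in> C \<Longrightarrow> dmon s t \<in> mpolys X"
  using finE[of t] subE[of t] unfolding dmon_def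
  by (intro mpolys_single) (auto simp: keys_sqf_monom)

text \<open>Every path from \<open>r\<close> to \<open>t\<close> carries the same monomial, that of
  \<open>E t - E r\<close>, which factors out of the scalar identity.\<close>

lemma dmon_square:
  assumes r: "r \<in> C" and t: "t \<in> C"
  shows "(\<Sum>s\<in>C. dmon r s * dmon s t) = 0"
proof -
  have "dmon r s * dmon s t = Poly_Mapping.single (sqf_monom (E t - E r)) (D r s * D s t)"
    if s: "s \<in> C" for s
  proof (cases "D r s = 0 \<or> D s t = 0")
    case False
    then have "E r \<subseteq> E s" "E s \<subseteq> E t" using degD r s t by auto
    then have "sqf_monom (E s - E r) + sqf_monom (E t - E s) = sqf_monom (E t - E r)"
    proof -
      have "E t - E r - (E s - E r) = E t - E s" "E s - E r \<subseteq> E t - E r"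
        using \<open>E r \<subseteq> E s\<close> \<open>E s \<subseteq> E t\<close> by auto
      then show ?thesis
        using sqf_monom_Diff_add[of "E t - E r" "E s - E r"] finE[OF t] by (simp add: add.commute)
    qed
    then show ?thesis by (simp add: dmon_def mult_single)
  qed (auto simp: dmon_def)
  then have "(\<Sum>s\<in>C. dmon r s * dmon s t) =
      Poly_Mapping.single (sqf_monom (E t - E r)) (\<Sum>s\<in>C. D r s * D s t)"
    unfolding single_sum by (rule sum.cong[OF refl])
  then show ?thesis using squareD[OF r t] by simp
qed

text \<open>The component of multidegree \<open>a\<close> of the module element with coordinates
  \<open>V\<close>, read as a vector of scalars. Its support consists of generators whose monomial
  divides \<open>a\<close>.\<close>

definition strand :: "('g \<Rightarrow> ('x, 'k) mpoly) \<Rightarrow> 'x monom \<Rightarrow> 'g \<Rightarrow> 'k" where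
  "strand V a s = (if E s \<subseteq> Poly_Mapping.keys a then Poly_Mapping.lookup (V s) (a - sqf_monom (E s)) else 0)"

text \<open>Subtraction of exponents is truncated at \<open>0\<close>; since \<open>T\<close> lies
  in the support of \<open>a\<close>, no truncation occurs.\<close>

lemma monom_split:
  assumes "finite T" "S \<subseteq> T" "T \<subseteq> Poly_Mapping.keys a"
  shows "sqf_monom (T - S) + (a - sqf_monom T) = a - sqf_monom S"
proof (rule poly_mapping_eqI)
  fix x
  have "x \<in> T \<Longrightarrow> Poly_Mapping.lookup a x \<ge> 1" using assms by (auto simp: in_keys_iff Suc_le_eq)
  moreover have "finite S" using assms finite_subset by blast
  ultimately show "Poly_Mapping.lookup (sqf_monom (T - S) + (a - sqf_monom T)) x =
      Poly_Mapping.lookup (a - sqf_monom S) x"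
    using assms by (auto simp: lookup_add lookup_minus lookup_sqf_monom)
qed

text \<open>As \<open>dmon\<close> preserves multidegrees, the differential acts in multidegree
  \<open>a\<close> as the scalar matrix \<open>D\<close> on the strand.\<close>

lemma lookup_dmon_mult:
  assumes r: "r \<in> C" and s: "s \<in> C" and a: "E r \<subseteq> Poly_Mapping.keys a"
  shows "Poly_Mapping.lookup (dmon r s * V s) (a - sqf_monom (E r)) = D r s * strand V a s"
proof (cases "D r s = 0")
  case True
  then show ?thesis by (simp add: dmon_def)
next
  case False
  then have sub: "E r \<subseteq> E s" using degD r s by simp
  show ?thesis
  proof (cases "E s \<subseteq> Poly_Mapping.keys a")
    case True
    then show ?thesis
      using lookup_single_mult(1)[of "sqf_monom (E s - E r)" "D r s" "V s" "a - sqf_monom (E s)"]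
        monom_split[OF finE[OF s] sub True] by (simp add: dmon_def strand_def)
  next
    case False
    then obtain x where x: "x \<in> E s" "x \<notin> Poly_Mapping.keys a" by blast
    have "a - sqf_monom (E r) \<noteq> sqf_monom (E s - E r) + q" for q
    proof
      assume "a - sqf_monom (E r) = sqf_monom (E s - E r) + q"
      then have "Poly_Mapping.lookup (a - sqf_monom (E r)) x = Poly_Mapping.lookup (sqf_monom (E s - E r) + q) x"
        by simp
      moreover have "x \<notin> E r" using a x by blast
      ultimately show False
        using x finE[OF r] finE[OF s] by (auto simp: lookup_minus lookup_add lookup_sqf_monom in_keys_iff)
    qed
    then show ?thesis using False by (simp add: dmon_def strand_def lookup_single_mult(2))
  qed
qed

text \<open>Exactness is checked one multidegree at a time. The component in multidegree
  \<open>a\<close> is a cycle of the strand over the support of \<open>a\<close>, hence a boundary,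
  and the preimages are reassembled into polynomials.\<close>

lemma dmon_exact:
  assumes V: "\<And>s. s \<in> C \<Longrightarrow> V s \<in> mpolys X" "\<And>s. s \<in> C \<Longrightarrow> V s \<noteq> 0 \<Longrightarrow> 0 < h s"
    and cyc: "\<And>r. r \<in> C \<Longrightarrow> (\<Sum>s\<in>C. dmon r s * V s) = 0"
  shows "\<exists>W. (\<forall>t\<in>C. W t \<in> mpolys X) \<and> (\<forall>s\<in>C. V s = (\<Sum>t\<in>C. dmon s t * W t))"
proof -
  have "\<exists>w. (\<forall>t\<in>C. w t \<noteq> 0 \<longrightarrow> E t \<subseteq> Poly_Mapping.keys a) \<and>
      (\<forall>s\<in>C. strand V a s = (\<Sum>t\<in>C. D s t * w t))" for a
  proof (rule strand_exact)
    fix s assume "s \<in> C" "strand V a s \<noteq> 0"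
    then show "0 < h s \<and> E s \<subseteq> Poly_Mapping.keys a"
      using V(2)[of s] by (cases "V s = 0") (auto simp: strand_def split: if_splits)
  next
    fix r assume r: "r \<in> C"
    show "(\<Sum>s\<in>C. D r s * strand V a s) = 0"
    proof (cases "E r \<subseteq> Poly_Mapping.keys a")
      case True
      have "(\<Sum>s\<in>C. D r s * strand V a s) =
          Poly_Mapping.lookup (\<Sum>s\<in>C. dmon r s * V s) (a - sqf_monom (E r))"
        unfolding lookup_sum by (intro sum.cong[OF refl] lookup_dmon_mult[OF r _ True, symmetric])
      then show ?thesis using cyc[OF r] by simp
    next
      case False
      have "D r s * strand V a s = 0" if "s \<in> C" for s
        using degD[OF r that] False by (auto simp: strand_def)
      then show ?thesis by (intro sum.neutral ballI)
    qed
  qed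
  then have "\<forall>a. \<exists>w. (\<forall>t\<in>C. w t \<noteq> 0 \<longrightarrow> E t \<subseteq> Poly_Mapping.keys a) \<and>
      (\<forall>s\<in>C. strand V a s = (\<Sum>t\<in>C. D s t * w t))" by blast
  then obtain w where w: "\<forall>a. (\<forall>t\<in>C. w a t \<noteq> 0 \<longrightarrow> E t \<subseteq> Poly_Mapping.keys a) \<and>
      (\<forall>s\<in>C. strand V a s = (\<Sum>t\<in>C. D s t * w a t))" by (rule choice[THEN exE])
  have w1: "E t \<subseteq> Poly_Mapping.keys a" if "t \<in> C" "w a t \<noteq> 0" for a t using w that by simp
  have w2: "strand V a s = (\<Sum>t\<in>C. D s t * w a t)" if "s \<in> C" for a s using w that by simp
  \<comment> \<open>The finitely many multidegrees in which \<open>V\<close> can have a nonzero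
    component; they make \<open>W\<close> a finite sum.\<close>
  define M where "M = (\<Union>s\<in>C. (\<lambda>b. b + sqf_monom (E s)) ` Poly_Mapping.keys (V s))"
  have finM: "finite M" using finC by (simp add: M_def)
  define W where "W = (\<lambda>t. \<Sum>a\<in>M. Poly_Mapping.single (a - sqf_monom (E t)) (w a t))"
  have "W t \<in> mpolys X" for t
    unfolding W_def
  proof (intro mpolys_sum mpolys_single)
    fix a assume "a \<in> M"
    then obtain s b where s: "s \<in> C" "b \<in> Poly_Mapping.keys (V s)" "a = b + sqf_monom (E s)"
      by (auto simp: M_def)
    have "Poly_Mapping.keys b \<subseteq> X" using V(1)[OF s(1)] s(2) by (simp add: mpolys_def)
    then have "Poly_Mapping.keys a \<subseteq> X"
      using Poly_Mapping.keys_add[of b "sqf_monom (E s)"] keys_sqf_monom[OF finE[OF s(1)]] subE[OF s(1)]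
      unfolding s(3) by blast
    moreover have "Poly_Mapping.keys (a - sqf_monom (E t)) \<subseteq> Poly_Mapping.keys a"
      by (auto simp: in_keys_iff lookup_minus)
    ultimately show "Poly_Mapping.keys (a - sqf_monom (E t)) \<subseteq> X" by blast
  qed
  moreover have "V s = (\<Sum>t\<in>C. dmon s t * W t)" if s: "s \<in> C" for s
  proof -
    have "dmon s t * Poly_Mapping.single (a - sqf_monom (E t)) (w a t) =
        Poly_Mapping.single (a - sqf_monom (E s)) (D s t * w a t)" if t: "t \<in> C" for a t
    proof (cases "D s t = 0 \<or> w a t = 0")
      case False
      then have "E s \<subseteq> E t" "E t \<subseteq> Poly_Mapping.keys a" using degD[OF s t] w1[OF t] by auto
      then show ?thesis using monom_split[OF finE[OF t]] by (simp add: dmon_def mult_single)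
    qed (auto simp: dmon_def)
    then have "(\<Sum>t\<in>C. dmon s t * W t) =
        (\<Sum>t\<in>C. \<Sum>a\<in>M. Poly_Mapping.single (a - sqf_monom (E s)) (D s t * w a t))"
      unfolding W_def sum_distrib_left by (intro sum.cong refl) simp
    also have "\<dots> = (\<Sum>a\<in>M. Poly_Mapping.single (a - sqf_monom (E s)) (strand V a s))"
      by (subst sum.swap) (simp add: w2[OF s] single_sum)
    also have "\<dots> = V s"
    proof (rule poly_mapping_eqI)
      fix b
      \<comment> \<open>The only multidegree contributing to the coefficient of \<open>b\<close> in
        coordinate \<open>s\<close>.\<close>
      define a0 where "a0 = b + sqf_monom (E s)"
      have sub0: "E s \<subseteq> Poly_Mapping.keys a0"
        using finE[OF s] by (auto simp: a0_def in_keys_iff lookup_add lookup_sqf_monom)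
      have "Poly_Mapping.lookup (\<Sum>a\<in>M. Poly_Mapping.single (a - sqf_monom (E s)) (strand V a s)) b =
          (\<Sum>a\<in>M. if a = a0 then strand V a0 s else 0)"
        unfolding lookup_sum
      proof (rule sum.cong[OF refl])
        fix a assume "a \<in> M"
        show "Poly_Mapping.lookup (Poly_Mapping.single (a - sqf_monom (E s)) (strand V a s)) b =
            (if a = a0 then strand V a0 s else 0)"
        proof (cases "E s \<subseteq> Poly_Mapping.keys a")
          case True
          have "a - sqf_monom (E s) = b \<longleftrightarrow> a = a0"
            using monom_split[OF finE[OF s] _ True, of "{}"]
            by (auto simp: a0_def add.commute lookup_minus)
          then show ?thesis by (auto simp: lookup_single when_def)
        next
          case False
          then show ?thesis using sub0 by (auto simp: strand_def)
        qed
      qed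
      also have "\<dots> = (if a0 \<in> M then strand V a0 s else 0)"
        using finM by simp
      also have "\<dots> = Poly_Mapping.lookup (V s) b"
      proof -
        have "strand V a0 s = Poly_Mapping.lookup (V s) b"
          using sub0 by (simp add: strand_def) (simp add: a0_def)
        moreover have "b \<in> Poly_Mapping.keys (V s) \<Longrightarrow> a0 \<in> M"
          using s by (auto simp: M_def a0_def)
        ultimately show ?thesis by (auto simp: in_keys_iff)
      qed
      finally show "Poly_Mapping.lookup (\<Sum>a\<in>M. Poly_Mapping.single (a - sqf_monom (E s)) (strand V a s)) b =
          Poly_Mapping.lookup (V s) b" .
    qed
    finally show ?thesis by simp
  qed
  ultimately show ?thesis by blast
qed

section \<open>Matrices of the differential\<close>

definition level :: "nat \<Rightarrow> 'g set" where
  "level i = {s \<in> C. h s = i}"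

definition betti :: "nat \<Rightarrow> nat" where
  "betti i = card (level i)"

definition enum :: "nat \<Rightarrow> nat \<Rightarrow> 'g" where
  "enum i = (SOME f. bij_betw f {..<betti i} (level i))"

definition diff_mat :: "nat \<Rightarrow> ('x, 'k) mpoly mat" where
  "diff_mat i = mat (betti (i - 1)) (betti i) (\<lambda>(r, c). dmon (enum (i - 1) r) (enum i c))"

definition multideg :: "nat \<Rightarrow> nat \<Rightarrow> 'x monom" where
  "multideg i j = sqf_monom (E (enum i j))"

lemma enum_bij: "bij_betw (enum i) {..<betti i} (level i)"
proof -
  have "finite (level i)" using finC by (simp add: level_def)
  then have "\<exists>f. bij_betw f {..<betti i} (level i)"
    unfolding betti_def using ex_bij_betw_nat_finite atLeast0LessThan by metis
  then show ?thesis unfolding enum_def by (rule someI_ex)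
qed

lemma enum_level: "j < betti i \<Longrightarrow> enum i j \<in> level i"
  using bij_betwE[OF enum_bij] by auto

lemma enum_C: "j < betti i \<Longrightarrow> enum i j \<in> C" and h_enum: "j < betti i \<Longrightarrow> h (enum i j) = i"
  using enum_level by (auto simp: level_def)

lemma level_enum: "s \<in> level i \<Longrightarrow> \<exists>j<betti i. s = enum i j"
  using bij_betw_imp_surj_on[OF enum_bij, of i] by (metis imageE lessThan_iff)

lemma sum_enum:
  assumes "\<And>s. s \<in> C \<Longrightarrow> h s \<noteq> i \<Longrightarrow> f s = 0"
  shows "(\<Sum>s\<in>C. f s) = (\<Sum>j<betti i. f (enum i j))"
proof -
  have "(\<Sum>s\<in>C. f s) = (\<Sum>s\<in>level i. f s)"
    using assms finC by (intro sum.mono_neutral_right) (auto simp: level_def)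
  also have "\<dots> = (\<Sum>j<betti i. f (enum i j))"
    by (rule sum.reindex_bij_betw[OF enum_bij, symmetric])
  finally show ?thesis .
qed

lemma dmon_eq_0: "s \<in> C \<Longrightarrow> t \<in> C \<Longrightarrow> h t \<noteq> Suc (h s) \<Longrightarrow> dmon s t = 0"
  using degD[of s t] by (cases "D s t = 0") (auto simp: dmon_def)

lemma diff_mat_poly_mats: "diff_mat (Suc i) \<in> poly_mats X (betti i) (betti (Suc i))"
  by (auto simp: poly_mats_def diff_mat_def intro!: dmon_mpolys enum_C)

lemma diff_mat_mult_vec:
  assumes "v \<in> free_mod X (betti (Suc i))" "r < betti i"
  shows "(diff_mat (Suc i) *\<^sub>v v) $ r = (\<Sum>j<betti (Suc i). dmon (enum i r) (enum (Suc i) j) * v $ j)"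
proof -
  have "dim_vec v = betti (Suc i)" using assms by (auto simp: free_mod_def)
  then show ?thesis using assms(2) by (simp add: diff_mat_def scalar_prod_def atLeast0LessThan)
qed

lemma diff_mat_square: "diff_mat (Suc i) * diff_mat (Suc (Suc i)) = 0\<^sub>m (betti i) (betti (Suc (Suc i)))"
proof (rule eq_matI)
  fix r c assume "r < dim_row (0\<^sub>m (betti i) (betti (Suc (Suc i))) :: ('x, 'k) mpoly mat)"
    "c < dim_col (0\<^sub>m (betti i) (betti (Suc (Suc i))) :: ('x, 'k) mpoly mat)"
  then have rc: "r < betti i" "c < betti (Suc (Suc i))" by auto
  note C = enum_C[OF rc(1)] enum_C[OF rc(2)]
  have "(diff_mat (Suc i) * diff_mat (Suc (Suc i))) $$ (r, c) =
      (\<Sum>j<betti (Suc i). dmon (enum i r) (enum (Suc i) j) * dmon (enum (Suc i) j) (enum (Suc (Suc i)) c))"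
    using rc by (simp add: diff_mat_def scalar_prod_def atLeast0LessThan)
  also have "\<dots> = (\<Sum>s\<in>C. dmon (enum i r) s * dmon s (enum (Suc (Suc i)) c))"
    using C dmon_eq_0[OF C(1)] h_enum[OF rc(1)] by (intro sum_enum[symmetric]) auto
  also have "\<dots> = 0" using dmon_square C by blast
  finally show "(diff_mat (Suc i) * diff_mat (Suc (Suc i))) $$ (r, c) =
      0\<^sub>m (betti i) (betti (Suc (Suc i))) $$ (r, c)" using rc by simp
qed (auto simp: diff_mat_def)

text \<open>A vector in one degree is extended by zero to a family on all of \<open>C\<close>, where
  \<open>dmon_exact\<close> applies.\<close>

lemma diff_mat_exact:
  "{v \<in> free_mod X (betti (Suc i)). diff_mat (Suc i) *\<^sub>v v = 0\<^sub>v (betti i)} =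
   (\<lambda>w. diff_mat (Suc (Suc i)) *\<^sub>v w) ` free_mod X (betti (Suc (Suc i)))" (is "?K = ?R")
proof
  show "?R \<subseteq> ?K"
  proof (rule image_subsetI)
    fix w :: "('x, 'k) mpoly vec" assume w: "w \<in> free_mod X (betti (Suc (Suc i)))"
    then have wc: "w \<in> carrier_vec (betti (Suc (Suc i)))" by (simp add: free_mod_def)
    have "diff_mat (Suc i) *\<^sub>v (diff_mat (Suc (Suc i)) *\<^sub>v w) =
        (diff_mat (Suc i) * diff_mat (Suc (Suc i))) *\<^sub>v w"
      by (rule assoc_mult_mat_vec[OF poly_matsD(1)[OF diff_mat_poly_mats]
            poly_matsD(1)[OF diff_mat_poly_mats] wc, symmetric])
    also have "\<dots> = 0\<^sub>v (betti i)"
      unfolding diff_mat_square using wc by (intro eq_vecI) auto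
    finally show "diff_mat (Suc (Suc i)) *\<^sub>v w \<in> ?K"
      using poly_mats_mult_vec[OF diff_mat_poly_mats w] by simp
  qed
  show "?K \<subseteq> ?R"
  proof
    fix v assume "v \<in> ?K"
    then have v: "v \<in> free_mod X (betti (Suc i))" "diff_mat (Suc i) *\<^sub>v v = 0\<^sub>v (betti i)" by auto
    define idx where "idx = inv_into {..<betti (Suc i)} (enum (Suc i))"
    have idx: "idx (enum (Suc i) j) = j" if "j < betti (Suc i)" for j
      unfolding idx_def using that enum_bij[of "Suc i"] by (auto simp: bij_betw_def)
    define V where "V = (\<lambda>s. if s \<in> level (Suc i) then v $ (idx s) else 0)"
    have V_enum: "V (enum (Suc i) j) = v $ j" if "j < betti (Suc i)" for j
      using that idx enum_level by (simp add: V_def)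
    have "\<exists>W. (\<forall>t\<in>C. W t \<in> mpolys X) \<and> (\<forall>s\<in>C. V s = (\<Sum>t\<in>C. dmon s t * W t))"
    proof (rule dmon_exact)
      fix s
      show "V s \<in> mpolys X"
      proof (cases "s \<in> level (Suc i)")
        case True
        then obtain j where "j < betti (Suc i)" "s = enum (Suc i) j" using level_enum by blast
        then show ?thesis using V_enum v(1) by (simp add: free_mod_def)
      qed (simp add: V_def)
      show "0 < h s" if "V s \<noteq> 0" using that by (auto simp: V_def level_def split: if_splits)
    next
      fix r assume r: "r \<in> C"
      show "(\<Sum>s\<in>C. dmon r s * V s) = 0"
      proof (cases "h r = i")
        case True
        then obtain k where k: "k < betti i" "r = enum i k"
          using r level_enum[of r i] by (auto simp: level_def)
        have "(\<Sum>s\<in>C. dmon r s * V s) = (\<Sum>j<betti (Suc i). dmon r (enum (Suc i) j) * V (enum (Suc i) j))"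
          by (rule sum_enum) (auto simp: V_def level_def)
        also have "\<dots> = (diff_mat (Suc i) *\<^sub>v v) $ k"
          unfolding diff_mat_mult_vec[OF v(1) k(1)] k(2)[symmetric]
          by (intro sum.cong) (auto simp: V_enum)
        finally show ?thesis using v(2) k(1) by simp
      next
        case False
        have "dmon r s * V s = 0" if "s \<in> C" for s
        proof (cases "h s = Suc i")
          case True
          then show ?thesis using dmon_eq_0[OF r that] False by simp
        qed (auto simp: V_def level_def)
        then show ?thesis by (intro sum.neutral ballI)
      qed
    qed
    then obtain W where W: "\<And>t. t \<in> C \<Longrightarrow> W t \<in> mpolys X"
      "\<And>s. s \<in> C \<Longrightarrow> V s = (\<Sum>t\<in>C. dmon s t * W t)" by auto
    \<comment> \<open>Only the components of \<open>W\<close> in degree \<open>Suc (Suc i)\<close>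
      contribute to a boundary in degree \<open>Suc i\<close>.\<close>
    define w where "w = vec (betti (Suc (Suc i))) (\<lambda>j. W (enum (Suc (Suc i)) j))"
    have w: "w \<in> free_mod X (betti (Suc (Suc i)))"
      using W(1) enum_C by (auto simp: w_def free_mod_def)
    have "v = diff_mat (Suc (Suc i)) *\<^sub>v w"
    proof (rule eq_vecI)
      fix j assume "j < dim_vec (diff_mat (Suc (Suc i)) *\<^sub>v w)"
      then have j: "j < betti (Suc i)" by (simp add: diff_mat_def)
      have "v $ j = (\<Sum>t\<in>C. dmon (enum (Suc i) j) t * W t)"
        using W(2)[OF enum_C[OF j]] V_enum[OF j] by simp
      also have "\<dots> = (\<Sum>k<betti (Suc (Suc i)). dmon (enum (Suc i) j) (enum (Suc (Suc i)) k) * W (enum (Suc (Suc i)) k))"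
        using dmon_eq_0[OF enum_C[OF j]] h_enum[OF j] by (intro sum_enum) auto
      also have "\<dots> = (diff_mat (Suc (Suc i)) *\<^sub>v w) $ j"
        unfolding diff_mat_mult_vec[OF w j] by (simp add: w_def)
      finally show "v $ j = (diff_mat (Suc (Suc i)) *\<^sub>v w) $ j" .
    qed (use v(1) in \<open>simp add: diff_mat_def free_mod_def\<close>)
    then show "v \<in> ?R" using w by blast
  qed
qed

end

text \<open>The single generator \<open>b0\<close> with the empty set makes the module in degree
  \<open>0\<close> the ring itself, and the normalisation \<open>D b0 t = 1\<close> makes the first
  differential the row of generators of the ideal.\<close>

locale augmented_squarefree_complex = squarefree_complex X C h E D
  for X :: "'x set" and C :: "'g set" and h :: "'g \<Rightarrow> nat" and E :: "'g \<Rightarrow> 'x set"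
    and D :: "'g \<Rightarrow> 'g \<Rightarrow> 'k::field" +
  fixes b0 :: 'g
  assumes level0: "level 0 = {b0}" and E0: "E b0 = {}" and D0: "t \<in> level 1 \<Longrightarrow> D b0 t = 1"
begin

definition span :: "('x, 'k) mpoly set" where
  "span = {\<Sum>t\<in>level 1. f t * Poly_Mapping.single (sqf_monom (E t)) 1 | f. \<forall>t\<in>level 1. f t \<in> mpolys X}"

lemma mpoly_ideal_level1: "mpoly_ideal X span"
  unfolding span_def
  using finE subE by (intro mpoly_ideal_span mpolys_single) (auto simp: level_def keys_sqf_monom)

lemma betti0: "betti 0 = 1"
  by (simp add: betti_def level0)

lemma enum0: "enum 0 0 = b0"
  using enum_level[of 0 0] by (simp add: betti0 level0)

lemma diff_mat_1:
  assumes "w \<in> free_mod X (betti 1)"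
  shows "(diff_mat 1 *\<^sub>v w) $ 0 = (\<Sum>j<betti 1. w $ j * Poly_Mapping.single (sqf_monom (E (enum 1 j))) 1)"
proof -
  have "dmon b0 (enum 1 j) = Poly_Mapping.single (sqf_monom (E (enum 1 j))) 1" if "j < betti 1" for j
    using D0[OF enum_level[OF that]] by (simp add: dmon_def E0)
  then show ?thesis using diff_mat_mult_vec[of w 0 0] assms
    by (simp add: betti0 enum0 mult.commute)
qed

lemma augmentation_exact:
  "{v \<in> free_mod X (betti 0). vec 1 (\<lambda>_. 1) \<bullet> v \<in> span} =
   (\<lambda>w. diff_mat 1 *\<^sub>v w) ` free_mod X (betti 1)" (is "?K = ?R")
proof -
  have eps: "vec 1 (\<lambda>_. 1) \<bullet> v = v $ 0" if "v \<in> free_mod X (betti 0)" for v :: "('x, 'k) mpoly vec"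
  proof -
    have "dim_vec v = 1" using that by (auto simp: free_mod_def betti0)
    then show ?thesis by (simp add: scalar_prod_def)
  qed
  have reindex: "(\<Sum>t\<in>level 1. f t * g t) = (\<Sum>j<betti 1. f (enum 1 j) * g (enum 1 j))"
    for f g :: "'g \<Rightarrow> ('x, 'k) mpoly"
    by (rule sum.reindex_bij_betw[OF enum_bij, symmetric])
  show ?thesis
  proof
    show "?K \<subseteq> ?R"
    proof
      fix v assume "v \<in> ?K"
      then have v: "v \<in> free_mod X (betti 0)" "v $ 0 \<in> span" using eps by auto
      then obtain f where f: "v $ 0 = (\<Sum>t\<in>level 1. f t * Poly_Mapping.single (sqf_monom (E t)) 1)"
        "\<forall>t\<in>level 1. f t \<in> mpolys X" unfolding span_def by blast
      define w where "w = vec (betti 1) (\<lambda>j. f (enum 1 j))"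
      have w: "w \<in> free_mod X (betti 1)"
        using f(2) enum_level by (auto simp: w_def free_mod_def)
      have "v = diff_mat 1 *\<^sub>v w"
      proof (rule eq_vecI)
        fix i assume "i < dim_vec (diff_mat 1 *\<^sub>v w)"
        then have "i = 0" by (simp add: diff_mat_def betti0)
        moreover have "v $ 0 = (diff_mat 1 *\<^sub>v w) $ 0"
          unfolding f(1) reindex diff_mat_1[OF w] by (intro sum.cong) (simp_all add: w_def)
        ultimately show "v $ i = (diff_mat 1 *\<^sub>v w) $ i" by simp
      qed (use v(1) in \<open>simp add: diff_mat_def free_mod_def\<close>)
      then show "v \<in> ?R" using w by blast
    qed
    show "?R \<subseteq> ?K"
    proof (rule image_subsetI)
      fix w :: "('x, 'k) mpoly vec" assume w: "w \<in> free_mod X (betti 1)"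
      define f where "f = (\<lambda>t. w $ (inv_into {..<betti 1} (enum 1) t))"
      have f: "f (enum 1 j) = w $ j" if "j < betti 1" for j
        unfolding f_def using that enum_bij[of 1] by (auto simp: bij_betw_def)
      have "(diff_mat 1 *\<^sub>v w) $ 0 = (\<Sum>t\<in>level 1. f t * Poly_Mapping.single (sqf_monom (E t)) 1)"
        unfolding diff_mat_1[OF w] reindex using f by (intro sum.cong) auto
      moreover have "\<forall>t\<in>level 1. f t \<in> mpolys X"
        using level_enum[of _ 1] f w by (force simp: free_mod_def)
      ultimately have "(diff_mat 1 *\<^sub>v w) $ 0 \<in> span" unfolding span_def by blast
      moreover have "diff_mat 1 *\<^sub>v w \<in> free_mod X (betti 0)"
        using poly_mats_mult_vec[OF diff_mat_poly_mats[of 0]] w by simp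
      ultimately show "diff_mat 1 *\<^sub>v w \<in> ?K" using eps by simp
    qed
  qed
qed

lemma multigraded_free_resolution_diff_mat:
  "multigraded_free_resolution X span betti multideg (vec 1 (\<lambda>_. 1)) diff_mat"
  unfolding multigraded_free_resolution_def
proof (intro conjI allI impI ballI)
  fix i j assume "j < betti i"
  then show "Poly_Mapping.keys (multideg i j) \<subseteq> X"
    using finE[OF enum_C] subE[OF enum_C] by (simp add: multideg_def keys_sqf_monom)
next
  show "vec 1 (\<lambda>_. 1) \<in> free_mod X (betti 0)" by (simp add: free_mod_def betti0)
next
  fix i
  show "diff_mat (Suc i) \<in> carrier_mat (betti i) (betti (Suc i))" by (simp add: diff_mat_def)
  show "elements_mat (diff_mat (Suc i)) \<subseteq> mpolys X"
    using diff_mat_poly_mats[of i] by (auto simp: poly_mats_def)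
  show "{v \<in> free_mod X (betti (Suc i)). diff_mat (Suc i) *\<^sub>v v = 0\<^sub>v (betti i)} =
      (\<lambda>w. diff_mat (Suc (Suc i)) *\<^sub>v w) ` free_mod X (betti (Suc (Suc i)))" by (rule diff_mat_exact)
next
  fix j a assume "j < betti 0" "a \<in> Poly_Mapping.keys (vec 1 (\<lambda>_. 1) $ j :: ('x, 'k) mpoly)"
  then show "a = multideg 0 j" by (simp add: betti0 multideg_def enum0 E0)
next
  fix i r c a assume rc: "r < betti i" "c < betti (Suc i)"
    and "a \<in> Poly_Mapping.keys (diff_mat (Suc i) $$ (r, c))"
  then have a: "a = sqf_monom (E (enum (Suc i) c) - E (enum i r))" "D (enum i r) (enum (Suc i) c) \<noteq> 0"
    by (auto simp: diff_mat_def dmon_def split: if_splits)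
  then show "a + multideg i r = multideg (Suc i) c"
    using degD[OF enum_C[OF rc(1)] enum_C[OF rc(2)]] finE[OF enum_C[OF rc(2)]]
    by (simp add: multideg_def sqf_monom_Diff_add)
next
  fix f :: "('x, 'k) mpoly" assume "f \<in> mpolys X"
  then show "\<exists>v\<in>free_mod X (betti 0). f - vec 1 (\<lambda>_. 1) \<bullet> v \<in> span"
    using mpoly_idealD(2)[OF mpoly_ideal_level1]
    by (intro bexI[of _ "vec 1 (\<lambda>_. f)"]) (auto simp: free_mod_def betti0 scalar_prod_def)
next
  show "{v \<in> free_mod X (betti 0). vec 1 (\<lambda>_. 1) \<bullet> v \<in> span} =
      (\<lambda>w. diff_mat 1 *\<^sub>v w) ` free_mod X (betti 1)" by (rule augmentation_exact)
qed

text \<open>A nonzero entry joins a set to a strictly larger one, so its monomial is not constant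
  and the resolution is minimal.\<close>

lemma betti_number_eq:
  assumes "\<And>s t. \<lbrakk>s \<in> C; t \<in> C; D s t \<noteq> 0\<rbrakk> \<Longrightarrow> E s \<noteq> E t"
  shows "betti_number X span i = card {s \<in> C. h s = i}"
proof -
  have "Poly_Mapping.lookup (dmon s t) 0 = 0" if "s \<in> C" "t \<in> C" for s t
  proof (cases "D s t = 0")
    case False
    then have "E s \<subset> E t" using degD[OF that] assms[OF that] by auto
    then have "Poly_Mapping.keys (sqf_monom (E t - E s)) \<noteq> {}"
      using finE[OF that(2)] by (subst keys_sqf_monom) auto
    then have "sqf_monom (E t - E s) \<noteq> 0" by auto
    then show ?thesis by (simp add: dmon_def lookup_single when_def)
  qed (simp add: dmon_def)
  then have "minimal_free_resolution X span betti multideg (vec 1 (\<lambda>_. 1)) diff_mat"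
    unfolding minimal_free_resolution_def
    using multigraded_free_resolution_diff_mat enum_C by (auto simp: diff_mat_def)
  then show ?thesis
    using betti_number_eqI[OF mpoly_ideal_level1] by (simp add: betti_def level_def)
qed

end

section \<open>Betti numbers of squarefree monomial ideals\<close>

text \<open>Levels below \<open>k\<close> are already reduced, so cancelling further pairs leaves them alone; the higher
  levels can only shrink.\<close>

lemma betti_number_reduction:
  fixes G :: "nat \<Rightarrow> 'x set"
  assumes G: "\<And>i. i < N \<Longrightarrow> finite (G i) \<and> G i \<subseteq> X \<and> G i \<noteq> {}"
    and C: "C \<subseteq> Pow {..<N}" "{s \<in> C. card s < 2} = {s \<in> Pow {..<N}. card s < 2}"
    and R: "sqf_resolution C card (\<lambda>s. \<Union>i\<in>s. G i) (D :: _ \<Rightarrow> _ \<Rightarrow> 'k::field)"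
    and D: "\<And>s t. \<lbrakk>s \<in> C; t \<in> C; card s < 2\<rbrakk> \<Longrightarrow> D s t = taylor_diff s t"
    and k: "2 \<le> k" "\<And>s t. \<lbrakk>s \<in> C; t \<in> C; card s < k; D s t \<noteq> 0\<rbrakk> \<Longrightarrow> (\<Union>i\<in>s. G i) \<noteq> (\<Union>i\<in>t. G i)"
  defines "I \<equiv> Idl\<^bsub>mpoly_ring X\<^esub> ((\<lambda>j. \<Prod>x\<in>G j. mvar x :: ('x, 'k) mpoly) ` {..<N})"
  shows "betti_number X I i \<le> card {s \<in> C. card s = i}"
    and "i < k \<Longrightarrow> betti_number X I i = card {s \<in> C. card s = i}"
proof -
  define E where "E = (\<lambda>s. \<Union>i\<in>s. G i)"
  have "\<exists>C' D'. sqf_resolution C' card E D' \<and> C' \<subseteq> C \<and> {s \<in> C'. card s < k} = {s \<in> C. card s < k} \<and>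
    (\<forall>s\<in>C'. \<forall>t\<in>C'. card s < k \<longrightarrow> D' s t = D s t) \<and>
    (\<forall>s\<in>C'. \<forall>t\<in>C'. D' s t \<noteq> 0 \<longrightarrow> E s \<noteq> E t)"
    using R k unfolding E_def by (intro ex_reduced_resolution) auto
  then obtain C' D' where C': "sqf_resolution C' card E D'" "C' \<subseteq> C"
    "{s \<in> C'. card s < k} = {s \<in> C. card s < k}"
    "\<forall>s\<in>C'. \<forall>t\<in>C'. card s < k \<longrightarrow> D' s t = D s t"
    "\<forall>s\<in>C'. \<forall>t\<in>C'. D' s t \<noteq> 0 \<longrightarrow> E s \<noteq> E t" by blast
  \<comment> \<open>As \<open>k \<ge> 2\<close>, the cancellations keep the empty set and all
    singletons, which represent the ring and the generators of the ideal.\<close>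
  have low: "s \<in> C' \<longleftrightarrow> s \<subseteq> {..<N}" if "card s < 2" for s
  proof -
    have "s \<in> C' \<longleftrightarrow> s \<in> {s \<in> C'. card s < k}" using that k(1) by simp
    also have "\<dots> \<longleftrightarrow> s \<in> {s \<in> C. card s < 2}" unfolding C'(3) using that k(1) by simp
    also have "\<dots> \<longleftrightarrow> s \<subseteq> {..<N}" unfolding C(2) using that by simp
    finally show ?thesis .
  qed
  have lev0: "{s \<in> C'. card s = 0} = {{}}"
  proof -
    \<comment> \<open>Infinite sets also have \<open>card s = 0\<close>, so finiteness has to be
      supplied.\<close>
    have "s = {}" if "s \<in> C'" "card s = 0" for s
    proof -
      have "finite s" using low[of s] that by (simp add: finite_subset)
      then show ?thesis using that by simp
    qed
    moreover have "{} \<in> C'" using low[of "{}"] by simp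
    ultimately show ?thesis by auto
  qed
  have lev1: "{s \<in> C'. card s = 1} = (\<lambda>j. {j}) ` {..<N}"
    using low by (auto simp: card_1_singleton_iff)
  interpret K: squarefree_complex X C' card E D'
  proof
    show "sqf_resolution C' card E D'" by (rule C')
    fix s assume "s \<in> C'"
    then have s: "s \<subseteq> {..<N}" using C' C by auto
    then show "finite (E s)" "E s \<subseteq> X" using G finite_subset[OF s] by (auto simp: E_def)
  qed
  interpret M: augmented_squarefree_complex X C' card E D' "{}"
  proof
    show "K.level 0 = {{}}" unfolding K.level_def by (rule lev0)
    show "E {} = {}" by (simp add: E_def)
    show "D' {} t = 1" if "t \<in> K.level 1" for t
    proof -
      have t: "t \<in> C'" "card t = 1" using that unfolding K.level_def by auto
      then obtain j where "t = {j}" by (auto simp: card_1_singleton_iff)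
      moreover have "{} \<in> C'" using low[of "{}"] by simp
      moreover have "D' {} t = D {} t" using C'(4) \<open>{} \<in> C'\<close> t(1) k(1) by simp
      moreover have "D {} t = taylor_diff {} t" using D[of "{}" t] \<open>{} \<in> C'\<close> t(1) C'(2) by auto
      ultimately show ?thesis using taylor_diff_insert[of j "{}"] by (simp add: taylor_sign_def)
    qed
  qed
  have "I = M.span"
  proof -
    have "I = Idl\<^bsub>mpoly_ring X\<^esub> ((\<lambda>t. Poly_Mapping.single (sqf_monom (E t)) 1) ` K.level 1)"
      unfolding I_def K.level_def lev1 image_image prod_mvar by (simp add: E_def)
    also have "\<dots> = M.span" unfolding M.span_def
    proof (rule genideal_mpoly_ring)
      show "finite (K.level 1)" unfolding K.level_def lev1 by simp
      show "Poly_Mapping.single (sqf_monom (E s)) 1 \<in> mpolys X" if "s \<in> K.level 1" for s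
      proof -
        have "s \<in> C'" using that by (simp add: K.level_def)
        then show ?thesis by (intro mpolys_single) (simp add: keys_sqf_monom K.finE K.subE)
      qed
    qed
    finally show ?thesis .
  qed
  have b: "betti_number X I i = card {s \<in> C'. card s = i}"
    unfolding \<open>I = M.span\<close> using C'(5) by (intro M.betti_number_eq) blast
  have "finite C" using C(1) finite_subset by blast
  then show "betti_number X I i \<le> card {s \<in> C. card s = i}"
    unfolding b using C'(2) by (intro card_mono) auto
  show "betti_number X I i = card {s \<in> C. card s = i}" if "i < k"
  proof -
    have "{s \<in> C'. card s = i} = {s \<in> {s \<in> C'. card s < k}. card s = i}" using that by auto
    also have "\<dots> = {s \<in> C. card s = i}" unfolding C'(3) using that by auto
    finally show ?thesis using b by simp
  qed
qed

text \<open>\<open>G i\<close> is the set of variables of the \<open>i\<close>-th generator;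
  \<open>antichain\<close> expresses that the generators are distinct and minimal.\<close>

locale squarefree_generators =
  fixes N :: nat and G :: "nat \<Rightarrow> 'x set" and X :: "'x set"
  assumes finG: "i < N \<Longrightarrow> finite (G i)" and subG: "i < N \<Longrightarrow> G i \<subseteq> X"
    and antichain: "\<lbrakk>i < N; j < N; G i \<subseteq> G j\<rbrakk> \<Longrightarrow> i = j" and ne: "i < N \<Longrightarrow> G i \<noteq> {}"
begin

definition gen_ideal :: "('x, 'k::field) mpoly set" where
  "gen_ideal = Idl\<^bsub>mpoly_ring X\<^esub> ((\<lambda>j. \<Prod>x\<in>G j. mvar x) ` {..<N})"

lemma card_subsets: "card {s \<in> Pow {..<N}. card s = i} = N choose i"
  using n_subsets[of "{..<N}" i] by (simp add: Pow_def)

text \<open>The two sets differ by one index, and its generator is not covered by the others, so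
  adding it enlarges the union.\<close>

lemma taylor_reduced:
  assumes "s \<in> Pow {..<N}" "t \<in> Pow {..<N}" "taylor_diff s t \<noteq> (0::'k::field)"
    "\<And>j. \<lbrakk>j < N; j \<notin> s; G j \<subseteq> (\<Union>i\<in>s. G i)\<rbrakk> \<Longrightarrow> False"
  shows "(\<Union>i\<in>s. G i) \<noteq> (\<Union>i\<in>t. G i)"
proof -
  obtain j where "j \<notin> s" "t = insert j s" using assms(3) by (rule taylor_diff_neq_0D)
  then show ?thesis using assms(2) assms(4)[of j] by auto
qed

text \<open>The empty cover is excluded by \<open>ne\<close>, a cover by one generator by
  \<open>antichain\<close>.\<close>

lemma not_covered_by_few:
  assumes "s \<subseteq> {..<N}" "card s < 2" "j < N" "j \<notin> s"
  shows "\<not> G j \<subseteq> (\<Union>i\<in>s. G i)"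
proof
  assume cov: "G j \<subseteq> (\<Union>i\<in>s. G i)"
  have "finite s" using assms(1) finite_subset by blast
  have "s \<noteq> {}" using cov ne[OF assms(3)] by auto
  then have "card s = 1" using assms(2) \<open>finite s\<close> by (cases "card s") auto
  then obtain i where "s = {i}" by (auto simp: card_1_singleton_iff)
  then show False using cov antichain[of j i] assms by auto
qed

text \<open>The Taylor complex is reduced below degree \<open>k\<close>, so its ranks there are the
  Betti numbers.\<close>

lemma betti_number_taylor:
  assumes "2 \<le> k" "i < k"
    and "\<And>s j. \<lbrakk>s \<subseteq> {..<N}; card s < k; j < N; j \<notin> s\<rbrakk> \<Longrightarrow> \<not> G j \<subseteq> (\<Union>i\<in>s. G i)"
  shows "betti_number X (gen_ideal :: ('x, 'k::field) mpoly set) i = N choose i"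
proof -
  have "betti_number X (gen_ideal :: ('x, 'k) mpoly set) i = card {s \<in> Pow {..<N}. card s = i}"
    unfolding gen_ideal_def
  proof (rule betti_number_reduction(2)[where k = k])
    show "sqf_resolution (Pow {..<N}) card (\<lambda>s. \<Union>i\<in>s. G i) (taylor_diff :: _ \<Rightarrow> _ \<Rightarrow> 'k)"
      by (rule taylor_resolution) simp
    show "(\<Union>i\<in>s. G i) \<noteq> (\<Union>i\<in>t. G i)"
      if "s \<in> Pow {..<N}" "t \<in> Pow {..<N}" "card s < k" "taylor_diff s t \<noteq> (0::'k)" for s t
      using that assms(3)[of s] by (intro taylor_reduced) auto
  qed (use finG subG ne assms in auto)
  then show ?thesis by (simp only: card_subsets)
qed

lemma betti_number_1: "betti_number X (gen_ideal :: ('x, 'k::field) mpoly set) 1 = N"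
  using betti_number_taylor[of 2 1] not_covered_by_few by simp

text \<open>The covering says that \<open>s\<close> and \<open>insert j s\<close> have the same
  union. Cancelling this pair in the Taylor complex removes a generator of degree
  \<open>Suc (card s)\<close>, and further cancellations cannot restore the rank.\<close>

lemma betti_number_less:
  assumes s: "s \<subseteq> {..<N}" and j: "j < N" "j \<notin> s" and cov: "G j \<subseteq> (\<Union>i\<in>s. G i)"
  shows "betti_number X (gen_ideal :: ('x, 'k::field) mpoly set) (Suc (card s)) < N choose Suc (card s)"
proof -
  define t where "t = insert j s"
  define C where "C = Pow {..<N} - {s, t}"
  define D :: "nat set \<Rightarrow> nat set \<Rightarrow> 'k" where
    "D = (\<lambda>u v. taylor_diff u v - taylor_diff u t * taylor_diff s v / taylor_diff s t)"
  have fin: "finite s" using s finite_subset by blast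
  have cs: "2 \<le> card s" using not_covered_by_few[OF s _ j] cov by (cases "card s < 2") auto
  have ct: "card t = Suc (card s)" using fin j by (simp add: t_def)
  have st: "s \<in> Pow {..<N}" "t \<in> Pow {..<N}" using s j by (auto simp: t_def)
  \<comment> \<open>\<open>t\<close> has at least three elements, so \<open>u\<close> with at most
    one element is not a facet of it.\<close>
  have D_low: "D u v = taylor_diff u v" if "card u < 2" for u v
  proof -
    have "taylor_diff u t = (0 :: 'k)"
    proof (rule ccontr)
      assume "taylor_diff u t \<noteq> (0 :: 'k)"
      then obtain i where "i \<notin> u" "t = insert i u" by (rule taylor_diff_neq_0D)
      then have "card t \<le> Suc (card u)" by (simp add: card_insert_le_m1 card_insert_if)
      then show False using ct cs that by simp
    qed
    then show ?thesis by (simp add: D_def)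
  qed
  \<comment> \<open>Only an upper bound is wanted, so it suffices that degrees \<open>0\<close> and
    \<open>1\<close> are reduced, i.e. \<open>k = 2\<close>.\<close>
  have "betti_number X (gen_ideal :: ('x, 'k) mpoly set) (card t) \<le> card {u \<in> C. card u = card t}"
    unfolding gen_ideal_def
  proof (rule betti_number_reduction(1)[where k = 2 and D = D])
    show "{u \<in> C. card u < 2} = {u \<in> Pow {..<N}. card u < 2}"
      using cs ct by (auto simp: C_def)
    show "sqf_resolution C card (\<lambda>s. \<Union>i\<in>s. G i) D"
      unfolding C_def D_def
    proof (rule cancel_pair)
      show "sqf_resolution (Pow {..<N}) card (\<lambda>s. \<Union>i\<in>s. G i) (taylor_diff :: _ \<Rightarrow> _ \<Rightarrow> 'k)"
        by (rule taylor_resolution) simp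
      show "taylor_diff s t \<noteq> (0 :: 'k)" using j by (simp add: t_def taylor_diff_insert)
      show "(\<Union>i\<in>s. G i) = (\<Union>i\<in>t. G i)" using cov by (auto simp: t_def)
      show "0 < card s" using cs by simp
    qed (use st in auto)
    show "D u v = taylor_diff u v" if "card u < 2" for u v using that by (rule D_low)
    show "(\<Union>i\<in>u. G i) \<noteq> (\<Union>i\<in>v. G i)"
      if "u \<in> C" "v \<in> C" "card u < 2" "D u v \<noteq> 0" for u v
    proof (rule taylor_reduced)
      show "taylor_diff u v \<noteq> (0 :: 'k)" using that D_low by simp
      show False if "i < N" "i \<notin> u" "G i \<subseteq> (\<Union>i\<in>u. G i)" for i
        using not_covered_by_few[of u i] \<open>u \<in> C\<close> \<open>card u < 2\<close> that by (auto simp: C_def)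
    qed (use that in \<open>auto simp: C_def\<close>)
  qed (use finG subG ne in \<open>auto simp: C_def\<close>)
  also have "\<dots> < card {u \<in> Pow {..<N}. card u = card t}"
    using st by (intro psubset_card_mono) (auto simp: C_def)
  finally show ?thesis by (simp only: card_subsets ct)
qed

end

section \<open>Block designs\<close>

text \<open>Double counting of the pairs of a block and a \<open>t\<close>-subset of it.\<close>

lemma sum_card_blocks:
  assumes "finite V" "B \<subseteq> nsets V k"
  shows "(\<Sum>T\<in>nsets V t. card {m \<in> B. T \<subseteq> m}) = card B * (k choose t)"
proof -
  have fB: "finite B" using assms finite_imp_finite_nsets finite_subset by metis
  have "(\<Sum>T\<in>nsets V t. card {m \<in> B. T \<subseteq> m}) = (\<Sum>T\<in>nsets V t. \<Sum>m\<in>B. if T \<subseteq> m then 1 else 0)"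
    using fB by (simp add: sum.If_cases Int_def)
  also have "\<dots> = (\<Sum>m\<in>B. \<Sum>T\<in>nsets V t. if T \<subseteq> m then 1 else 0)"
    by (rule sum.swap)
  also have "\<dots> = (\<Sum>m\<in>B. k choose t)"
  proof (rule sum.cong)
    fix m assume "m \<in> B"
    then have m: "m \<subseteq> V" "finite m" "card m = k" using assms by (auto simp: nsets_def)
    have "(\<Sum>T\<in>nsets V t. if T \<subseteq> m then 1 else 0 :: nat) = card (nsets V t \<inter> {T. T \<subseteq> m})"
      using finite_imp_finite_nsets[OF assms(1), of t] by (simp add: sum.If_cases Int_def)
    also have "nsets V t \<inter> {T. T \<subseteq> m} = nsets m t" using m by (auto simp: nsets_def)
    also have "card (nsets m t) = k choose t" using m by (simp add: card_nsets)
    finally show "(\<Sum>T\<in>nsets V t. if T \<subseteq> m then 1 else 0) = k choose t" .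
  qed simp
  finally show ?thesis by simp
qed

lemma card_nsets_atLeastAtMost: "card (nsets {1..n::nat} k) = n choose k"
  by (simp add: card_nsets)

section \<open>Pairs and triples in a Steiner system\<close>

lemma steiner_system_card:
  assumes "steiner_system t k n B"
  shows "card B * (k choose t) = n choose t"
proof -
  have B: "B \<subseteq> nsets {1..n} k" and u: "\<And>T. T \<in> nsets {1..n} t \<Longrightarrow> \<exists>!m. m \<in> B \<and> T \<subseteq> m"
    using assms by (auto simp: steiner_system_def)
  have "card {m \<in> B. T \<subseteq> m} = 1" if "T \<in> nsets {1..n} t" for T
  proof -
    obtain m' where "m' \<in> B \<and> T \<subseteq> m'" "\<And>m. m \<in> B \<and> T \<subseteq> m \<Longrightarrow> m = m'"
      using u[OF \<open>T \<in> nsets {1..n} t\<close>] by (elim ex1E) blast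
    then have "{m \<in> B. T \<subseteq> m} = {m'}" by blast
    then show ?thesis by simp
  qed
  then have "(\<Sum>T\<in>nsets {1..n} t. card {m \<in> B. T \<subseteq> m}) = n choose t"
    using card_nsets_atLeastAtMost[of n t] by simp
  then show ?thesis using sum_card_blocks[OF _ B, of t] by simp
qed

text \<open>Two distinct common pairs would yield a triple contained in both blocks.\<close>

lemma steiner_blocks_share_one_edge:
  assumes "steiner_system 3 4 n B" "m \<in> B" "m' \<in> B" "m \<noteq> m'"
  shows "card (nsets m 2 \<inter> nsets m' 2) \<le> 1"
proof (rule ccontr)
  assume "\<not> ?thesis"
  then have "Suc 0 < card (nsets m 2 \<inter> nsets m' 2)" by simp
  then obtain e f where ef: "e \<in> nsets m 2 \<inter> nsets m' 2" "f \<in> nsets m 2 \<inter> nsets m' 2" "e \<noteq> f"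
    by (metis card_le_Suc0_iff_eq card.infinite not_le zero_less_Suc less_imp_le)
  have mV: "m \<subseteq> {1..n}" "m' \<subseteq> {1..n}" using assms by (auto simp: steiner_system_def nsets_def)
  have e2: "finite e" "card e = 2" "finite f" "card f = 2" using ef by (auto simp: nsets_def)
  then have "\<not> f \<subseteq> e" using ef(3) by (metis card_subset_eq)
  then obtain x where x: "x \<in> f" "x \<notin> e" by blast
  then have "insert x e \<in> nsets {1..n} 3" "insert x e \<subseteq> m" "insert x e \<subseteq> m'"
    using e2 ef mV by (auto simp: nsets_def)
  then show False using assms unfolding steiner_system_def by blast
qed

text \<open>Each of the at most five other blocks covers at most one of the six pairs in
  \<open>m\<close>.\<close>

lemma steiner_edges_not_covered:
  assumes "steiner_system 3 4 n B" "m \<in> B" "F \<subseteq> B" "m \<notin> F" "card F \<le> 5" "finite F"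
  shows "\<not> nsets m 2 \<subseteq> (\<Union>m'\<in>F. nsets m' 2)"
proof
  assume cov: "nsets m 2 \<subseteq> (\<Union>m'\<in>F. nsets m' 2)"
  have m: "finite m" "card m = 4" using assms(1,2) by (auto simp: steiner_system_def nsets_def)
  have "6 = card (nsets m 2)" using m by (simp add: card_nsets choose_two)
  also have "nsets m 2 = (\<Union>m'\<in>F. nsets m 2 \<inter> nsets m' 2)" using cov by blast
  also have "card \<dots> \<le> (\<Sum>m'\<in>F. card (nsets m 2 \<inter> nsets m' 2))"
    using assms(6) by (rule card_UN_le)
  also have "\<dots> \<le> (\<Sum>m'\<in>F. 1)"
    using steiner_blocks_share_one_edge[OF assms(1,2)] assms(3,4) by (intro sum_mono) blast
  also have "\<dots> \<le> 5" using assms(5) by simp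
  finally show False by simp
qed

section \<open>Families in which no block is covered by four others\<close>

text \<open>Let \<open>d\<close> be the point of \<open>m\<close> outside \<open>T\<close>. The
  block \<open>m'\<close> covers the three pairs in \<open>T\<close>; if each of the three pairs
  through \<open>d\<close> lay in another block too, then four blocks would cover
  \<open>m\<close>.\<close>

lemma private_edge:
  assumes B: "B \<subseteq> nsets V 4"
    and irr: "\<And>m F. \<lbrakk>m \<in> B; F \<subseteq> B; m \<notin> F; finite F; card F \<le> 4\<rbrakk> \<Longrightarrow>
            \<not> nsets m 2 \<subseteq> (\<Union>m'\<in>F. nsets m' 2)"
    and m: "m \<in> B" "m' \<in> B" "m \<noteq> m'" "T \<in> nsets V 3" "T \<subseteq> m" "T \<subseteq> m'"
  shows "\<exists>e\<in>nsets m 2. \<forall>m''\<in>B. e \<subseteq> m'' \<longrightarrow> m'' = m"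
proof (rule ccontr)
  assume neg: "\<not> ?thesis"
  have "\<exists>g. \<forall>e\<in>nsets m 2. g e \<in> B \<and> e \<subseteq> g e \<and> g e \<noteq> m"
    using neg by (intro bchoice) blast
  then obtain g where g: "\<And>e. e \<in> nsets m 2 \<Longrightarrow> g e \<in> B \<and> e \<subseteq> g e \<and> g e \<noteq> m"
    by blast
  have mc: "finite m" "card m = 4" using B m by (auto simp: nsets_def)
  have T: "finite T" "card T = 3" using m by (auto simp: nsets_def)
  have "card (m - T) = 1" using mc T m by (simp add: card_Diff_subset)
  then obtain d where d: "m - T = {d}" by (auto simp: card_1_singleton_iff)
  then have dm: "d \<in> m" "d \<notin> T" "m = insert d T" using m by auto
  define F where "F = insert m' ((\<lambda>x. g {d, x}) ` T)"
  have dx: "{d, x} \<in> nsets m 2" if "x \<in> T" for x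
    using that dm by (auto simp: doubleton_in_nsets_2)
  have "F \<subseteq> B" using g dx m by (auto simp: F_def)
  moreover have "m \<notin> F"
  proof
    assume "m \<in> F"
    then obtain x where "x \<in> T" "g {d, x} = m" using m by (auto simp: F_def)
    then show False using g[OF dx[of x]] by blast
  qed
  moreover have "finite F" using T by (simp add: F_def)
  moreover have "card F \<le> 4"
  proof -
    have "card F \<le> Suc (card ((\<lambda>x. g {d, x}) ` T))" unfolding F_def using card_insert_le_m1 T
      by (simp add: card_insert_if)
    also have "\<dots> \<le> Suc (card T)" using T(1) card_image_le by simp
    finally show ?thesis using T by simp
  qed
  moreover have "nsets m 2 \<subseteq> (\<Union>m'\<in>F. nsets m' 2)"
  proof
    fix e assume e: "e \<in> nsets m 2"
    show "e \<in> (\<Union>m'\<in>F. nsets m' 2)"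
    proof (cases "d \<in> e")
      case True
      obtain x y where xy: "e = {x, y}" "x \<in> m" "y \<in> m" "x \<noteq> y" using e by (elim nsets2_E)
      obtain u where u: "e = {d, u}" "u \<in> T" using True xy dm by auto
      have "e \<in> nsets (g {d, u}) 2" using g[OF dx[OF u(2)]] e u(1) by (auto simp: nsets_def)
      then show ?thesis using u by (auto simp: F_def)
    next
      case False
      then have "e \<subseteq> T" using e dm by (auto simp: nsets_def)
      then have "e \<in> nsets m' 2" using e m by (auto simp: nsets_def)
      then show ?thesis by (auto simp: F_def)
    qed
  qed
  ultimately show False using irr[OF m(1)] by blast
qed

text \<open>\<open>U\<close> collects the uncovered triples, \<open>W\<close> the multiply covered
  ones and \<open>Bad\<close> the blocks containing a triple of \<open>W\<close>. Private pairs
  force many uncovered triples, whereas the average multiplicity \<open>1\<close> allows only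
  few.\<close>

lemma steiner_system_if_irredundant:
  assumes n: "10 < n" and B: "B \<subseteq> nsets {1..n} 4" and card: "4 * card B = n choose 3"
    and irr: "\<And>m F. \<lbrakk>m \<in> B; F \<subseteq> B; m \<notin> F; finite F; card F \<le> 4\<rbrakk> \<Longrightarrow>
            \<not> nsets m 2 \<subseteq> (\<Union>m'\<in>F. nsets m' 2)"
  shows "steiner_system 3 4 n B"
proof -
  define V where "V = {1..n}"
  define Tr where "Tr = nsets V 3"
  define c where "c = (\<lambda>T. card {m \<in> B. T \<subseteq> m})"
  define U where "U = {T \<in> Tr. c T = 0}"
  define W where "W = {T \<in> Tr. 2 \<le> c T}"
  define Bad where "Bad = {m \<in> B. \<exists>T\<in>W. T \<subseteq> m}"
  have finV: "finite V" by (simp add: V_def)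
  have finT: "finite Tr" unfolding Tr_def using finV by (rule finite_imp_finite_nsets)
  have finB: "finite B" using B finite_imp_finite_nsets[of "{1..n}"] finite_subset by blast
  have finBad: "finite Bad" "finite U" "finite W"
    using finB finT by (auto simp: Bad_def U_def W_def)
  have c43: "(4::nat) choose 3 = 4" by (simp add: eval_nat_numeral)
  have sumc: "(\<Sum>T\<in>Tr. c T) = card Tr"
    using sum_card_blocks[OF _ B, of 3] card card_nsets_atLeastAtMost[of n 3]
    by (simp add: c_def Tr_def V_def c43)
  \<comment> \<open>The multiplicities \<open>c\<close> sum to the number of triples. Bounding
    \<open>c T\<close> by \<open>0\<close> on \<open>U\<close>, by \<open>1\<close> on triples
    covered once and by \<open>1 + c T\<close> on \<open>W\<close> gives the estimate.\<close>
  have UW: "card U \<le> (\<Sum>T\<in>W. c T)"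
  proof -
    have "card Tr = (\<Sum>T\<in>Tr. c T)" using sumc by simp
    also have "\<dots> \<le> (\<Sum>T\<in>Tr. (if T \<in> U then 0 else 1) + (if T \<in> W then c T else 0))"
      by (rule sum_mono) (auto simp: U_def W_def)
    also have "\<dots> = card (Tr - U) + (\<Sum>T\<in>W. c T)"
    proof -
      have "Tr \<inter> - U = Tr - U" "Tr \<inter> W = W" by (auto simp: W_def)
      then show ?thesis using finT by (simp add: sum.distrib sum.If_cases)
    qed
    also have "card (Tr - U) = card Tr - card U"
      using finBad by (intro card_Diff_subset) (auto simp: U_def)
    finally have "card Tr \<le> card Tr - card U + (\<Sum>T\<in>W. c T)" .
    moreover have "card U \<le> card Tr" using finT by (intro card_mono) (auto simp: U_def)
    ultimately show ?thesis by linarith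
  qed
  have "\<exists>e\<in>nsets m 2. \<forall>m''\<in>B. e \<subseteq> m'' \<longrightarrow> m'' = m" if "m \<in> Bad" for m
  proof -
    obtain T where T: "m \<in> B" "T \<in> W" "T \<subseteq> m" using \<open>m \<in> Bad\<close> by (auto simp: Bad_def)
    then have "\<not> {m \<in> B. T \<subseteq> m} \<subseteq> {m}"
      using card_mono[of "{m}" "{m \<in> B. T \<subseteq> m}"] by (auto simp: W_def c_def)
    then obtain m' where "m' \<in> B" "T \<subseteq> m'" "m' \<noteq> m" by blast
    then show ?thesis using private_edge[OF B irr, of m m' T] T by (auto simp: W_def Tr_def V_def)
  qed
  then have "\<exists>e. \<forall>m\<in>Bad. e m \<in> nsets m 2 \<and> (\<forall>m''\<in>B. e m \<subseteq> m'' \<longrightarrow> m'' = m)"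
    by (intro bchoice) blast
  then obtain e where *: "\<forall>m\<in>Bad. e m \<in> nsets m 2 \<and> (\<forall>m''\<in>B. e m \<subseteq> m'' \<longrightarrow> m'' = m)" ..
  have e: "e m \<in> nsets m 2" if "m \<in> Bad" for m using * that by simp
  have epriv: "m'' = m" if "m \<in> Bad" "m'' \<in> B" "e m \<subseteq> m''" for m m'' using * that by simp
  have mfin: "finite m" "card m = 4" "m \<subseteq> V" if "m \<in> Bad" for m
    using that B by (auto simp: Bad_def nsets_def V_def)
  have upper: "(\<Sum>T\<in>W. c T) \<le> 2 * card Bad"
  proof -
    have "(\<Sum>T\<in>W. c T) = (\<Sum>T\<in>W. \<Sum>m\<in>Bad. if T \<subseteq> m then 1 else 0)"
    proof (rule sum.cong)
      fix T assume "T \<in> W"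
      then have "{m \<in> B. T \<subseteq> m} = {m \<in> Bad. T \<subseteq> m}" by (auto simp: Bad_def)
      then show "c T = (\<Sum>m\<in>Bad. if T \<subseteq> m then 1 else 0)"
        using finBad by (simp add: c_def sum.If_cases Int_def)
    qed simp
    also have "\<dots> = (\<Sum>m\<in>Bad. card {T \<in> W. T \<subseteq> m})"
      by (subst sum.swap) (use finBad in \<open>simp add: sum.If_cases Int_def\<close>)
    also have "\<dots> \<le> (\<Sum>m\<in>Bad. 2)"
    proof (rule sum_mono)
      fix m assume m: "m \<in> Bad"
      have em: "e m \<subseteq> m" "card (e m) = 2" "finite (e m)" using e[OF m] by (auto simp: nsets_def)
      \<comment> \<open>A triple containing the private pair lies in no other block, so a triple of
        \<open>W\<close> in \<open>m\<close> omits one of the two points of that pair.\<close>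
      have "{T \<in> W. T \<subseteq> m} \<subseteq> (\<lambda>x. m - {x}) ` e m"
      proof
        fix T assume T: "T \<in> {T \<in> W. T \<subseteq> m}"
        then have Tc: "card T = 3" "finite T" by (auto simp: W_def Tr_def nsets_def)
        have "\<not> e m \<subseteq> T"
        proof
          assume "e m \<subseteq> T"
          then have "{m' \<in> B. T \<subseteq> m'} \<subseteq> {m}" using epriv[OF m] by blast
          then have "c T \<le> 1" using card_mono[of "{m}" "{m' \<in> B. T \<subseteq> m'}"] by (simp add: c_def)
          then show False using T by (simp add: W_def)
        qed
        then obtain x where x: "x \<in> e m" "x \<notin> T" by blast
        have "T = m - {x}"
          using T x em Tc mfin[OF m] by (intro card_subset_eq) auto
        then show "T \<in> (\<lambda>x. m - {x}) ` e m" using x by blast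
      qed
      then have "card {T \<in> W. T \<subseteq> m} \<le> card (e m)"
        using em by (meson surj_card_le)
      then show "card {T \<in> W. T \<subseteq> m} \<le> 2" using em by simp
    qed
    finally show ?thesis by simp
  qed
  have lower: "card Bad * (n - 4) \<le> 3 * card U"
  proof -
    have "card Bad * (n - 4) = (\<Sum>m\<in>Bad. n - 4)" by simp
    also have "\<dots> \<le> (\<Sum>m\<in>Bad. card {T \<in> U. e m \<subseteq> T})"
    proof (rule sum_mono)
      fix m assume m: "m \<in> Bad"
      have em: "e m \<subseteq> m" "card (e m) = 2" "finite (e m)" using e[OF m] by (auto simp: nsets_def)
      \<comment> \<open>A block containing \<open>e m\<close> equals \<open>m\<close>, so adding a
        point outside \<open>m\<close> gives a triple in no block.\<close>
      have "(\<lambda>w. insert w (e m)) ` (V - m) \<subseteq> {T \<in> U. e m \<subseteq> T}"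
      proof (clarsimp, intro conjI)
        fix w assume w: "w \<in> V" "w \<notin> m"
        have "{m' \<in> B. insert w (e m) \<subseteq> m'} = {}" using epriv[OF m] w by auto
        moreover have "insert w (e m) \<in> Tr"
        proof -
          have "w \<notin> e m" using w em by blast
          then have "card (insert w (e m)) = 3" using em by simp
          then show ?thesis using w em mfin[OF m] by (auto simp: Tr_def nsets_def)
        qed
        ultimately show "insert w (e m) \<in> U" unfolding U_def c_def by (simp only: card.empty mem_Collect_eq)
      qed auto
      then have "card ((\<lambda>w. insert w (e m)) ` (V - m)) \<le> card {T \<in> U. e m \<subseteq> T}"
        using finBad by (intro card_mono) auto
      moreover have "card ((\<lambda>w. insert w (e m)) ` (V - m)) = n - 4"
      proof -
        have "inj_on (\<lambda>w. insert w (e m)) (V - m)" using em by (auto simp: inj_on_def)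
        then show ?thesis using mfin[OF m] by (simp add: card_image card_Diff_subset V_def)
      qed
      ultimately show "n - 4 \<le> card {T \<in> U. e m \<subseteq> T}" by simp
    qed
    also have "\<dots> = (\<Sum>m\<in>Bad. \<Sum>T\<in>U. if e m \<subseteq> T then 1 else 0)"
      using finBad by (simp add: sum.If_cases Int_def)
    also have "\<dots> = (\<Sum>T\<in>U. card {m \<in> Bad. e m \<subseteq> T})"
      by (subst sum.swap) (use finBad in \<open>simp add: sum.If_cases Int_def\<close>)
    \<comment> \<open>Distinct blocks have distinct private pairs, and a triple contains three
      pairs.\<close>
    also have "\<dots> \<le> (\<Sum>T\<in>U. 3)"
    proof (rule sum_mono)
      fix T assume "T \<in> U"
      then have T: "finite T" "card T = 3" by (auto simp: U_def Tr_def nsets_def)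
      have "inj_on e {m \<in> Bad. e m \<subseteq> T}"
      proof (rule inj_onI)
        fix m m' assume a: "m \<in> {m \<in> Bad. e m \<subseteq> T}" "m' \<in> {m \<in> Bad. e m \<subseteq> T}" "e m = e m'"
        then have "e m \<subseteq> m'" using e[of m'] by (simp add: nsets_def)
        moreover have "m \<in> Bad" "m' \<in> B" using a(1,2) by (simp_all add: Bad_def)
        ultimately show "m = m'" using epriv[of m m'] by simp
      qed
      moreover have "e ` {m \<in> Bad. e m \<subseteq> T} \<subseteq> nsets T 2"
        using e by (fastforce simp: nsets_def)
      ultimately have "card {m \<in> Bad. e m \<subseteq> T} \<le> card (nsets T 2)"
        using T finite_imp_finite_nsets by (metis card_inj_on_le)
      also have "\<dots> = 3" using T by (simp add: card_nsets choose_two)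
      finally show "card {m \<in> Bad. e m \<subseteq> T} \<le> 3" .
    qed
    finally show ?thesis by simp
  qed
  \<comment> \<open>The factor \<open>6\<close> is \<open>3 * 2\<close> from the two counts, and
    \<open>n > 10\<close> makes \<open>n - 4\<close> larger.\<close>
  have "card Bad * (n - 4) \<le> card Bad * 6" using lower UW upper by linarith
  then have "card Bad = 0" using n by (auto simp: mult_le_cancel1)
  then have "card U = 0" using UW upper by simp
  have c1: "c T = 1" if "T \<in> Tr" for T
  proof (rule ccontr)
    assume "c T \<noteq> 1"
    moreover have "T \<notin> U" using \<open>card U = 0\<close> finBad by simp
    ultimately have "T \<in> W" using that by (auto simp: U_def W_def)
    moreover from this have "card {m \<in> B. T \<subseteq> m} \<noteq> 0" by (simp add: W_def c_def)
    then have "{m \<in> B. T \<subseteq> m} \<noteq> {}" by (metis card.empty)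
    then obtain m where "m \<in> B" "T \<subseteq> m" by blast
    ultimately have "m \<in> Bad" by (auto simp: Bad_def)
    then show False using \<open>card Bad = 0\<close> finBad by auto
  qed
  have "\<exists>!m. m \<in> B \<and> T \<subseteq> m" if "T \<in> nsets {1..n} 3" for T
  proof -
    have "card {m \<in> B. T \<subseteq> m} = 1" using c1[of T] that by (simp add: c_def Tr_def V_def)
    then obtain m where m: "{m \<in> B. T \<subseteq> m} = {m}" by (rule card_1_singletonE)
    show ?thesis
    proof (rule ex1I[of _ m])
      show "m \<in> B \<and> T \<subseteq> m" using m by blast
      fix m' assume "m' \<in> B \<and> T \<subseteq> m'"
      then have "m' \<in> {m \<in> B. T \<subseteq> m}" by simp
      then show "m' = m" unfolding m by simp
    qed
  qed
  then show ?thesis using B by (simp add: steiner_system_def)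
qed

section \<open>Blocks as generators of the shadow ideal\<close>

theorem corollary4p6:
  fixes n :: nat and B :: "nat set set" and p :: real
  assumes "n > 10"
    and "B \<subseteq> nsets {1..n} 4"
    and "p = real (n choose 3) / 4"
  shows "steiner_system 3 4 n B \<longleftrightarrow>
    (\<forall>i\<in>{0..5}. real (betti_number (nsets {1..n} 2)
        (shadow_ideal 2 n B :: (nat set, 'k::field) mpoly set) i) = p gchoose i)"
proof -
  define X where "X = nsets {1..n} 2"
  define N where "N = card B"
  have finB: "finite B" using assms(2) finite_imp_finite_nsets[of "{1..n}"] finite_subset by blast
  obtain m where bij: "bij_betw m {..<N} B"
    unfolding N_def using ex_bij_betw_nat_finite[OF finB] atLeast0LessThan by metis
  define G where "G = (\<lambda>j. nsets (m j) 2)"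
  have mB: "m j \<in> B" if "j < N" for j using bij_betwE[OF bij] that by simp
  have m_block: "m j \<subseteq> {1..n}" "finite (m j)" "card (m j) = 4" if "j < N" for j
    using mB[OF that] assms(2) by (auto simp: nsets_def)
  have m_inj: "i = j" if "i < N" "j < N" "m i = m j" for i j
    using bij that by (auto simp: bij_betw_def inj_on_def)
  interpret squarefree_generators N G X
  proof
    fix i j assume i: "i < N"
    show "finite (G i)" unfolding G_def using m_block(2)[OF i] by (rule finite_imp_finite_nsets)
    show "G i \<subseteq> X" unfolding G_def X_def using m_block(1)[OF i] by (rule nsets_mono)
    have "card (G i) = 6" unfolding G_def using m_block[OF i] by (simp add: card_nsets choose_two)
    then show "G i \<noteq> {}" by auto
    assume j: "j < N" and sub: "G i \<subseteq> G j"
    \<comment> \<open>A block is the union of its pairs, so inclusion of pair sets gives inclusion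
      of blocks, and blocks have equal size.\<close>
    have "m i \<subseteq> m j"
    proof
      fix x assume x: "x \<in> m i"
      have "m i \<noteq> {x}" using m_block(3)[OF i] by auto
      then obtain y where "y \<in> m i" "y \<noteq> x" using x by blast
      then have "{x, y} \<in> nsets (m i) 2" using x by (simp only: doubleton_in_nsets_2) simp
      then have "{x, y} \<in> nsets (m j) 2" using sub unfolding G_def by blast
      then show "x \<in> m j" by (simp only: doubleton_in_nsets_2)
    qed
    then have "m i = m j" using m_block[OF i] m_block[OF j] by (metis card_subset_eq)
    then show "i = j" using m_inj i j by blast
  qed
  have ideal: "shadow_ideal 2 n B = (gen_ideal :: (nat set, 'k) mpoly set)"
  proof -
    have "B = m ` {..<N}" using bij by (simp add: bij_betw_def)
    then show ?thesis
      unfolding gen_ideal_def unfolding shadow_ideal_def X_def G_def by (simp only: image_image)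
  qed
  have c43: "(4::nat) choose 3 = 4" by (simp add: eval_nat_numeral)
  show ?thesis
  proof
    assume S: "steiner_system 3 4 n B"
    have "N * 4 = n choose 3" using steiner_system_card[OF S] c43 by (simp add: N_def)
    then have p: "p = real N" using assms(3) by (metis nonzero_mult_div_cancel_right of_nat_mult of_nat_numeral zero_neq_numeral)
    show "\<forall>i\<in>{0..5}. real (betti_number (nsets {1..n} 2)
        (shadow_ideal 2 n B :: (nat set, 'k) mpoly set) i) = p gchoose i"
    proof
      fix i :: nat assume "i \<in> {0..5}"
      \<comment> \<open>\<open>k = 6\<close> reaches degree \<open>5\<close>, and the covers to be
        excluded have at most five blocks.\<close>
      have "betti_number X (gen_ideal :: (nat set, 'k) mpoly set) i = N choose i"
      proof (rule betti_number_taylor[where k = 6])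
        fix s j assume s: "s \<subseteq> {..<N}" "card s < 6" and j: "j < N" "j \<notin> s"
        have fin: "finite s" using s finite_subset by blast
        have "m j \<notin> m ` s" using j s m_inj by blast
        moreover have "card (m ` s) \<le> 5" using card_image_le[OF fin, of m] s by simp
        moreover have "m ` s \<subseteq> B" using s mB by auto
        ultimately have "\<not> nsets (m j) 2 \<subseteq> (\<Union>m'\<in>m ` s. nsets m' 2)"
          using steiner_edges_not_covered[OF S mB[OF j(1)]] fin by blast
        then show "\<not> G j \<subseteq> (\<Union>i\<in>s. G i)" by (simp add: G_def)
      qed (use \<open>i \<in> {0..5}\<close> in auto)
      then show "real (betti_number (nsets {1..n} 2)
          (shadow_ideal 2 n B :: (nat set, 'k) mpoly set) i) = p gchoose i"
        unfolding ideal p X_def[symmetric] using binomial_gbinomial[of N i, where 'a = real] by simp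
    qed
  next
    assume betti: "\<forall>i\<in>{0..5}. real (betti_number (nsets {1..n} 2)
        (shadow_ideal 2 n B :: (nat set, 'k) mpoly set) i) = p gchoose i"
    then have betti_i: "real (betti_number X (gen_ideal :: (nat set, 'k) mpoly set) i) = p gchoose i"
      if "i \<le> 5" for i using that by (simp add: ideal X_def)
    \<comment> \<open>Degree \<open>1\<close> counts the generators, so it already determines the
      number of blocks.\<close>
    have p: "p = real N" using betti_i[of 1] betti_number_1[where 'k = 'k] by simp
    then have bin: "betti_number X (gen_ideal :: (nat set, 'k) mpoly set) i = N choose i" if "i \<le> 5" for i
      using betti_i[OF that] by (simp add: binomial_gbinomial[symmetric])
    have "4 * card B = n choose 3"
    proof -
      have "real (4 * card B) = real (n choose 3)" using p assms(3) by (simp add: N_def)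
      then show ?thesis by (simp only: of_nat_eq_iff)
    qed
    then show "steiner_system 3 4 n B"
    proof (rule steiner_system_if_irredundant[OF assms(1,2)])
      fix b F assume b: "b \<in> B" "F \<subseteq> B" "b \<notin> F" "finite F" "card F \<le> 4"
      show "\<not> nsets b 2 \<subseteq> (\<Union>m'\<in>F. nsets m' 2)"
      proof
        assume cov: "nsets b 2 \<subseteq> (\<Union>m'\<in>F. nsets m' 2)"
        obtain j where j: "j < N" "b = m j" using bij b(1) by (auto simp: bij_betw_def)
        define s where "s = {i \<in> {..<N}. m i \<in> F}"
        have F: "F = m ` s" using bij b(2) by (auto simp: s_def bij_betw_def)
        have "inj_on m s" using m_inj by (auto simp: inj_on_def s_def)
        then have cs: "card s \<le> 4" using b(5) F by (simp add: card_image)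
        \<comment> \<open>The drop occurs in degree \<open>Suc (card s) \<le> 5\<close>, within the
          prescribed range.\<close>
        have "betti_number X (gen_ideal :: (nat set, 'k) mpoly set) (Suc (card s)) < N choose Suc (card s)"
        proof (rule betti_number_less)
          show "s \<subseteq> {..<N}" "j < N" using j(1) by (auto simp: s_def)
          show "j \<notin> s" using b(3) j(2) by (simp add: s_def)
          have "(\<Union>m'\<in>F. nsets m' 2) = (\<Union>i\<in>s. G i)"
            by (subst F) (simp add: G_def)
          then show "G j \<subseteq> (\<Union>i\<in>s. G i)" using cov j(2) by (simp add: G_def)
        qed
        then show False using bin[of "Suc (card s)"] cs by simp
      qed
    qed
  qed
qed

end
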